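(* Let $G_1,G_2$ be profinite groups, let $(A_1,B_1,C_1)$ be a Tate product over $G_1$ and $(A_2,B_2,C_2)$ a Tate product over $G_2$, and let $(\phi,\psi):(A_1,B_1,C_1)\to(A_2,B_2,C_2)$ be a morphism of Tate products. Let $r,s\ge0$. Then for all $\alpha''\in H^r(G_1,A_1'')$ and $\beta''\in H^s(G_1,B_1'')$, $$(\phi,\psi_C)^*(\alpha''\cup_{\mathrm{aug}}\beta'')=(\phi,\psi_{A''})^*(\alpha'')\cup_{\mathrm{aug}}(\phi,\psi_{B''})^*(\beta'')\quad\text{in } H^{r+s+1}(G_2,C_2).$$
   Context: For a profinite group $G$ and a discrete $G$-module $A$, $C^r(G,A)$ is the group of continuous maps $G^r\to A$, with coboundary $d_rf(x_1,\ldots,x_{r+1})=x_1 f(x_2,\ldots,x_{r+1})+\sum_{i=1}^r(-1)^i f(x_1,\ldots,x_ix_{i+1},\ldots,x_{r+1})+(-1)^{r+1}f(x_1,\ldots,x_r)$; $Z^r=\ker d_r$, $B^r=\operatorname{im} d_{r-1}$, $H^r=Z^r/B^r$. A map $A\times B\to C$, $(a,b)\mapsto a\times b$, of discrete $G$-modules is $G$-bilinear if it is bilinear and $g(a\times b)=ga\times gb$. It induces the cup product $\cup:C^r(G,A)\times C^s(G,B)\to C^{r+s}(G,C)$, $(f\cup g)(x_1,\ldots,x_{r+s})=f(x_1,\ldots,x_r)\times x_1\cdots x_r\, g(x_{r+1},\ldots,x_{r+s})$. A Tate product $(A,B,C)$ over $G$ consists of two short exact sequences of discrete $G$-modules $0\to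 A'\xrightarrow{i}A\xrightarrow{j}A''\to0$ and $0\to B'\xrightarrow{i}B\xrightarrow{j}B''\to0$, a discrete $G$-module $C$, and two $G$-bilinear maps $A'\times B\to C$ and $A\times B'\to C$ that coincide on $A'\times B'$. One identifies $C^r(G,A')$ with $\ker(j_*:C^r(G,A)\to C^r(G,A''))$, and similarly for $B'$. Augmented cup product $\cup_{\mathrm{aug}}:H^r(G,A'')\times H^s(G,B'')\to H^{r+s+1}(G,C)$: given $\alpha'',\beta''$, choose $f\in C^r(G,A)$, $g\in C^s(G,B)$ with $j_*f,j_*g$ cocycles representing $\alpha'',\beta''$; then $d_rf\in C^{r+1}(G,A')$, $d_sg\in C^{s+1}(G,B')$, and $\alpha''\cup_{\mathrm{aug}}\beta''=[d_rf\cup g+(-1)^rf\cup d_sg]$ (well defined). If $\phi:G_2\to G_1$ is a morphism of profinite groups, $A_i$ a discrete $G_i$-module and $\psi:A_1\to A_2$ a homomorphism of abelian groups, $(\phi,\psi)$ is a morphism of discrete modules if $\psi(\phi(g)a)=g\psi(a)$ for $g\in G_2,a\in A_1$. It induces $(\phi,\psi)^*:H^r(G_1,A_1)\to H^r(G_2,A_2)$, $[f]\mapsto[\psi\circ f\circ\phi]$, where $(\psi\circ f\circ\phi)(\sigma_1,\ldots,\sigma_r)=\psi(f(\phi(\sigma_1),\ldots,\phi(\sigma_r)))$. A morphism of Tate products $(\phi,\psi)$ as in the claim consists of a morphism of profinite groups $\phi:G_2\to G_1$ and homomorphisms of abelian groups $\psi_{A'}:A_1'\to A_2'$, $\psi_A:A_1\to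 A_2$, $\psi_{A''}:A_1''\to A_2''$, $\psi_{B'}:B_1'\to B_2'$, $\psi_B:B_1\to B_2$, $\psi_{B''}:B_1''\to B_2''$, $\psi_C:C_1\to C_2$ such that: (1) $(\psi_{A'},\psi_A,\psi_{A''})$ and $(\psi_{B'},\psi_B,\psi_{B''})$ are morphisms (commutative ladders) between the respective short exact sequences; (2) each of these seven maps together with $\phi$ is a morphism of discrete modules; (3) $\psi_C(a'\times b)=\psi_{A'}(a')\times\psi_B(b)$ for $a'\in A_1',b\in B_1$, and $\psi_C(a\times b')=\psi_A(a)\times\psi_{B'}(b')$ for $a\in A_1,b'\in B_1'$. *)

theory Defs
  imports "HOL-Analysis.Analysis" "HOL-Algebra.Algebra"
begin

section \<open>Profinite groups and discrete modules\<close>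

record 'g top_group = "'g monoid" +
  group_top :: "'g topology"

text \<open>The last conjunct says that the group is totally disconnected.\<close>

definition profinite_group :: "'g top_group \<Rightarrow> bool" where
  "profinite_group G \<longleftrightarrow>
     group G \<and> topspace (group_top G) = carrier G \<and>
     continuous_map (prod_topology (group_top G) (group_top G)) (group_top G)
       (\<lambda>(x, y). x \<otimes>\<^bsub>G\<^esub> y) \<and>
     continuous_map (group_top G) (group_top G) (\<lambda>x. inv\<^bsub>G\<^esub> x) \<and>
     compact_space (group_top G) \<and> Hausdorff_space (group_top G) \<and>
     (\<forall>S. connectedin (group_top G) S \<longrightarrow> (\<exists>x. S \<subseteq> {x}))"

definition profinite_hom :: "'g top_group \<Rightarrow> 'h top_group \<Rightarrow> ('g \<Rightarrow> 'h) \<Rightarrow> bool" where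
  "profinite_hom G H \<phi> \<longleftrightarrow>
     \<phi> \<in> hom G H \<and> continuous_map (group_top G) (group_top H) \<phi>"

text \<open>A \<open>G\<close>-module is an additive abelian group \<open>A\<close> in the record type \<open>('g, 'a) module\<close>, whose
  scalar multiplication \<open>\<odot>\<close> is the action of \<open>G\<close>. The multiplicative fields inherited from the
  ring record are never used.\<close>

definition discrete_module :: "'g top_group \<Rightarrow> ('g, 'a) module \<Rightarrow> bool" where
  "discrete_module G A \<longleftrightarrow>
     abelian_group A \<and>
     (\<forall>g\<in>carrier G. \<forall>a\<in>carrier A. g \<odot>\<^bsub>A\<^esub> a \<in> carrier A) \<and>
     (\<forall>a\<in>carrier A. \<one>\<^bsub>G\<^esub> \<odot>\<^bsub>A\<^esub> a = a) \<and>
     (\<forall>g\<in>carrier G. \<forall>h\<in>carrier G. \<forall>a\<in>carrier A.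
        (g \<otimes>\<^bsub>G\<^esub> h) \<odot>\<^bsub>A\<^esub> a = g \<odot>\<^bsub>A\<^esub> (h \<odot>\<^bsub>A\<^esub> a)) \<and>
     (\<forall>g\<in>carrier G. \<forall>a\<in>carrier A. \<forall>b\<in>carrier A.
        g \<odot>\<^bsub>A\<^esub> (a \<oplus>\<^bsub>A\<^esub> b) = g \<odot>\<^bsub>A\<^esub> a \<oplus>\<^bsub>A\<^esub> g \<odot>\<^bsub>A\<^esub> b) \<and>
     continuous_map (prod_topology (group_top G) (discrete_topology (carrier A)))
       (discrete_topology (carrier A)) (\<lambda>(g, a). g \<odot>\<^bsub>A\<^esub> a)"

text \<open>\<open>(\<phi>, \<psi>)\<close> is a morphism from the \<open>G\<^sub>1\<close>-module \<open>A\<^sub>1\<close> to the \<open>G\<^sub>2\<close>-module \<open>A\<^sub>2\<close>; note that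
  \<open>\<phi>\<close> goes from \<open>G\<^sub>2\<close> to \<open>G\<^sub>1\<close>. For \<open>\<phi> = id\<close> these are the homomorphisms of \<open>G\<close>-modules.\<close>

definition module_morphism ::
  "'g1 top_group \<Rightarrow> ('g1, 'a1) module \<Rightarrow> 'g2 top_group \<Rightarrow> ('g2, 'a2) module \<Rightarrow>
   ('g2 \<Rightarrow> 'g1) \<Rightarrow> ('a1 \<Rightarrow> 'a2) \<Rightarrow> bool" where
  "module_morphism G1 A1 G2 A2 \<phi> \<psi> \<longleftrightarrow>
     profinite_hom G2 G1 \<phi> \<and> \<psi> \<in> hom (add_monoid A1) (add_monoid A2) \<and>
     (\<forall>g\<in>carrier G2. \<forall>a\<in>carrier A1. \<psi> (\<phi> g \<odot>\<^bsub>A1\<^esub> a) = g \<odot>\<^bsub>A2\<^esub> \<psi> a)"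

definition short_exact ::
  "'g top_group \<Rightarrow> ('g, 'a1) module \<Rightarrow> ('a1 \<Rightarrow> 'a) \<Rightarrow> ('g, 'a) module \<Rightarrow> ('a \<Rightarrow> 'a2) \<Rightarrow>
   ('g, 'a2) module \<Rightarrow> bool" where
  "short_exact G A' i A j A'' \<longleftrightarrow>
     discrete_module G A' \<and> discrete_module G A \<and> discrete_module G A'' \<and>
     module_morphism G A' G A id i \<and> module_morphism G A G A'' id j \<and>
     i \<in> mon (add_monoid A') (add_monoid A) \<and>
     j \<in> epi (add_monoid A) (add_monoid A'') \<and>
     i ` carrier A' = kernel (add_monoid A) (add_monoid A'') j"

definition G_bilinear ::
  "'g top_group \<Rightarrow> ('g, 'a) module \<Rightarrow> ('g, 'b) module \<Rightarrow> ('g, 'c) module \<Rightarrow>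
   ('a \<Rightarrow> 'b \<Rightarrow> 'c) \<Rightarrow> bool" where
  "G_bilinear G A B C p \<longleftrightarrow>
     (\<forall>a\<in>carrier A. \<forall>b\<in>carrier B. p a b \<in> carrier C) \<and>
     (\<forall>a\<in>carrier A. \<forall>a'\<in>carrier A. \<forall>b\<in>carrier B.
        p (a \<oplus>\<^bsub>A\<^esub> a') b = p a b \<oplus>\<^bsub>C\<^esub> p a' b) \<and>
     (\<forall>a\<in>carrier A. \<forall>b\<in>carrier B. \<forall>b'\<in>carrier B.
        p a (b \<oplus>\<^bsub>B\<^esub> b') = p a b \<oplus>\<^bsub>C\<^esub> p a b') \<and>
     (\<forall>g\<in>carrier G. \<forall>a\<in>carrier A. \<forall>b\<in>carrier B.
        g \<odot>\<^bsub>C\<^esub> p a b = p (g \<odot>\<^bsub>A\<^esub> a) (g \<odot>\<^bsub>B\<^esub> b))"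


section \<open>Continuous cochains and cohomology\<close>

text \<open>The tuple \<open>(x\<^sub>1, \<dots>, x\<^sub>r)\<close> is the extensional function on \<open>{..<r}\<close> whose value at \<open>k\<close> is
  \<open>x\<^sub>k\<^sub>+\<^sub>1\<close>. Cochains are extensional on the set of tuples, so that equality of cochains is equality
  of functions. The abelian group of cochains is written multiplicatively (its product is pointwise
  addition), so that the library's \<open>kernel\<close> and \<open>Mod\<close> apply.\<close>

definition tuples :: "'g top_group \<Rightarrow> nat \<Rightarrow> (nat \<Rightarrow> 'g) set" where
  "tuples G r = {..<r} \<rightarrow>\<^sub>E carrier G"

definition cochains ::
  "'g top_group \<Rightarrow> ('g, 'a) module \<Rightarrow> nat \<Rightarrow> ((nat \<Rightarrow> 'g) \<Rightarrow> 'a) monoid" where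
  "cochains G A r =
     \<lparr>carrier = {f \<in> extensional (tuples G r).
         continuous_map (product_topology (\<lambda>_. group_top G) {..<r})
           (discrete_topology (carrier A)) f},
      mult = (\<lambda>f g. \<lambda>x\<in>tuples G r. f x \<oplus>\<^bsub>A\<^esub> g x),
      one = (\<lambda>x\<in>tuples G r. \<zero>\<^bsub>A\<^esub>)\<rparr>"

text \<open>For \<open>x\<close> of length \<open>r + 1\<close> and \<open>1 \<le> i \<le> r\<close>, the tuple \<open>(x\<^sub>1, \<dots>, x\<^sub>i x\<^sub>i\<^sub>+\<^sub>1, \<dots>, x\<^sub>r\<^sub>+\<^sub>1)\<close>.\<close>

definition merge_at :: "'g top_group \<Rightarrow> nat \<Rightarrow> nat \<Rightarrow> (nat \<Rightarrow> 'g) \<Rightarrow> nat \<Rightarrow> 'g" where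
  "merge_at G r i x =
     (\<lambda>k\<in>{..<r}. if Suc k < i then x k
                 else if Suc k = i then x k \<otimes>\<^bsub>G\<^esub> x (Suc k)
                 else x (Suc k))"

definition coboundary ::
  "'g top_group \<Rightarrow> ('g, 'a) module \<Rightarrow> nat \<Rightarrow> ((nat \<Rightarrow> 'g) \<Rightarrow> 'a) \<Rightarrow> (nat \<Rightarrow> 'g) \<Rightarrow> 'a" where
  "coboundary G A r f =
     (\<lambda>x\<in>tuples G (Suc r).
        x 0 \<odot>\<^bsub>A\<^esub> f (\<lambda>k\<in>{..<r}. x (Suc k))
        \<oplus>\<^bsub>A\<^esub> (\<Oplus>\<^bsub>A\<^esub>i\<in>{1..r}. add_pow A ((- 1 :: int) ^ i) (f (merge_at G r i x)))
        \<oplus>\<^bsub>A\<^esub> add_pow A ((- 1 :: int) ^ Suc r) (f (restrict x {..<r})))"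

definition cocycles ::
  "'g top_group \<Rightarrow> ('g, 'a) module \<Rightarrow> nat \<Rightarrow> ((nat \<Rightarrow> 'g) \<Rightarrow> 'a) set" where
  "cocycles G A r = kernel (cochains G A r) (cochains G A (Suc r)) (coboundary G A r)"

text \<open>In degree \<open>0\<close> the incoming coboundary map is the one from the zero group.\<close>

definition coboundaries ::
  "'g top_group \<Rightarrow> ('g, 'a) module \<Rightarrow> nat \<Rightarrow> ((nat \<Rightarrow> 'g) \<Rightarrow> 'a) set" where
  "coboundaries G A r =
     (case r of 0 \<Rightarrow> {\<one>\<^bsub>cochains G A 0\<^esub>}
      | Suc q \<Rightarrow> coboundary G A q ` carrier (cochains G A q))"

definition cohomology ::
  "'g top_group \<Rightarrow> ('g, 'a) module \<Rightarrow> nat \<Rightarrow> ((nat \<Rightarrow> 'g) \<Rightarrow> 'a) set monoid" where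
  "cohomology G A r =
     (cochains G A r)\<lparr>carrier := cocycles G A r\<rparr> Mod coboundaries G A r"

definition cohom_class ::
  "'g top_group \<Rightarrow> ('g, 'a) module \<Rightarrow> nat \<Rightarrow> ((nat \<Rightarrow> 'g) \<Rightarrow> 'a) \<Rightarrow> ((nat \<Rightarrow> 'g) \<Rightarrow> 'a) set" where
  "cohom_class G A r f = coboundaries G A r #>\<^bsub>cochains G A r\<^esub> f"

definition pull_cochain ::
  "'g2 top_group \<Rightarrow> ('g2 \<Rightarrow> 'g1) \<Rightarrow> ('a1 \<Rightarrow> 'a2) \<Rightarrow> nat \<Rightarrow> ((nat \<Rightarrow> 'g1) \<Rightarrow> 'a1) \<Rightarrow>
   (nat \<Rightarrow> 'g2) \<Rightarrow> 'a2" where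
  "pull_cochain G2 \<phi> \<psi> r f = (\<lambda>x\<in>tuples G2 r. \<psi> (f (\<lambda>k\<in>{..<r}. \<phi> (x k))))"

text \<open>\<open>THE\<close> picks the class that every choice of representative leads to; the same encoding is used
  for the augmented cup product, where the choices are the lifts \<open>f\<close> and \<open>g\<close>.\<close>

definition induced_map ::
  "'g1 top_group \<Rightarrow> ('g1, 'a1) module \<Rightarrow> 'g2 top_group \<Rightarrow> ('g2, 'a2) module \<Rightarrow>
   ('g2 \<Rightarrow> 'g1) \<Rightarrow> ('a1 \<Rightarrow> 'a2) \<Rightarrow> nat \<Rightarrow>
   ((nat \<Rightarrow> 'g1) \<Rightarrow> 'a1) set \<Rightarrow> ((nat \<Rightarrow> 'g2) \<Rightarrow> 'a2) set" where
  "induced_map G1 A1 G2 A2 \<phi> \<psi> r \<alpha> =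
     (THE \<gamma>. \<exists>f\<in>cocycles G1 A1 r. cohom_class G1 A1 r f = \<alpha> \<and>
             \<gamma> = cohom_class G2 A2 r (pull_cochain G2 \<phi> \<psi> r f))"

definition push_cochain ::
  "'g top_group \<Rightarrow> ('a \<Rightarrow> 'b) \<Rightarrow> nat \<Rightarrow> ((nat \<Rightarrow> 'g) \<Rightarrow> 'a) \<Rightarrow> (nat \<Rightarrow> 'g) \<Rightarrow> 'b" where
  "push_cochain G h r f = (\<lambda>x\<in>tuples G r. h (f x))"

definition cup ::
  "'g top_group \<Rightarrow> ('g, 'b) module \<Rightarrow> ('a \<Rightarrow> 'b \<Rightarrow> 'c) \<Rightarrow> nat \<Rightarrow> nat \<Rightarrow>
   ((nat \<Rightarrow> 'g) \<Rightarrow> 'a) \<Rightarrow> ((nat \<Rightarrow> 'g) \<Rightarrow> 'b) \<Rightarrow> (nat \<Rightarrow> 'g) \<Rightarrow> 'c" where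
  "cup G B p r s f g =
     (\<lambda>x\<in>tuples G (r + s).
        p (f (restrict x {..<r}))
          (foldr (mult G) (map x [0..<r]) \<one>\<^bsub>G\<^esub> \<odot>\<^bsub>B\<^esub> g (\<lambda>k\<in>{..<s}. x (r + k))))"


section \<open>Tate products and the augmented cup product\<close>

text \<open>The fields \<open>pair1\<close> and \<open>pair2\<close> are the bilinear maps \<open>A' \<times> B \<rightarrow> C\<close> and \<open>A \<times> B' \<rightarrow> C\<close>.\<close>

record ('g, 'a1, 'a, 'a2, 'b1, 'b, 'b2, 'c) tate =
  modA' :: "('g, 'a1) module"
  modA :: "('g, 'a) module"
  modA'' :: "('g, 'a2) module"
  inclA :: "'a1 \<Rightarrow> 'a"
  projA :: "'a \<Rightarrow> 'a2"
  modB' :: "('g, 'b1) module"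
  modB :: "('g, 'b) module"
  modB'' :: "('g, 'b2) module"
  inclB :: "'b1 \<Rightarrow> 'b"
  projB :: "'b \<Rightarrow> 'b2"
  modC :: "('g, 'c) module"
  pair1 :: "'a1 \<Rightarrow> 'b \<Rightarrow> 'c"
  pair2 :: "'a \<Rightarrow> 'b1 \<Rightarrow> 'c"

definition tate_product ::
  "'g top_group \<Rightarrow> ('g, 'a1, 'a, 'a2, 'b1, 'b, 'b2, 'c) tate \<Rightarrow> bool" where
  "tate_product G P \<longleftrightarrow>
     short_exact G (modA' P) (inclA P) (modA P) (projA P) (modA'' P) \<and>
     short_exact G (modB' P) (inclB P) (modB P) (projB P) (modB'' P) \<and>
     discrete_module G (modC P) \<and>
     G_bilinear G (modA' P) (modB P) (modC P) (pair1 P) \<and>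
     G_bilinear G (modA P) (modB' P) (modC P) (pair2 P) \<and>
     (\<forall>a\<in>carrier (modA' P). \<forall>b\<in>carrier (modB' P).
        pair1 P a (inclB P b) = pair2 P (inclA P a) b)"

text \<open>Applying \<open>inv_into (carrier A') i\<close> realizes the identification of \<open>ker j\<^sub>*\<close> with
  the cochains with values in \<open>A'\<close>. The exponent of \<open>[^]\<close> is the sign \<open>(-1)\<^sup>r\<close>, as the cochain
  group is written multiplicatively.\<close>

definition aug_cochain ::
  "'g top_group \<Rightarrow> ('g, 'a1, 'a, 'a2, 'b1, 'b, 'b2, 'c) tate \<Rightarrow> nat \<Rightarrow> nat \<Rightarrow>
   ((nat \<Rightarrow> 'g) \<Rightarrow> 'a) \<Rightarrow> ((nat \<Rightarrow> 'g) \<Rightarrow> 'b) \<Rightarrow> (nat \<Rightarrow> 'g) \<Rightarrow> 'c" where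
  "aug_cochain G P r s f g =
     (let df = push_cochain G (inv_into (carrier (modA' P)) (inclA P)) (Suc r)
                 (coboundary G (modA P) r f);
          dg = push_cochain G (inv_into (carrier (modB' P)) (inclB P)) (Suc s)
                 (coboundary G (modB P) s g);
          K = cochains G (modC P) (r + s + 1)
      in cup G (modB P) (pair1 P) (Suc r) s df g
         \<otimes>\<^bsub>K\<^esub> (cup G (modB' P) (pair2 P) r (Suc s) f dg [^]\<^bsub>K\<^esub> ((- 1 :: int) ^ r)))"

definition aug_cup ::
  "'g top_group \<Rightarrow> ('g, 'a1, 'a, 'a2, 'b1, 'b, 'b2, 'c) tate \<Rightarrow> nat \<Rightarrow> nat \<Rightarrow>
   ((nat \<Rightarrow> 'g) \<Rightarrow> 'a2) set \<Rightarrow> ((nat \<Rightarrow> 'g) \<Rightarrow> 'b2) set \<Rightarrow> ((nat \<Rightarrow> 'g) \<Rightarrow> 'c) set" where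
  "aug_cup G P r s \<alpha> \<beta> =
     (THE \<gamma>. \<exists>f\<in>carrier (cochains G (modA P) r). \<exists>g\<in>carrier (cochains G (modB P) s).
        push_cochain G (projA P) r f \<in> cocycles G (modA'' P) r \<and>
        cohom_class G (modA'' P) r (push_cochain G (projA P) r f) = \<alpha> \<and>
        push_cochain G (projB P) s g \<in> cocycles G (modB'' P) s \<and>
        cohom_class G (modB'' P) s (push_cochain G (projB P) s g) = \<beta> \<and>
        \<gamma> = cohom_class G (modC P) (r + s + 1) (aug_cochain G P r s f g))"

record ('a1, 'c1, 'a, 'c, 'a2, 'c2, 'b1, 'd1, 'b, 'd, 'b2, 'd2, 'e, 'f) tate_maps =
  mapA' :: "'a1 \<Rightarrow> 'c1"
  mapA :: "'a \<Rightarrow> 'c"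
  mapA'' :: "'a2 \<Rightarrow> 'c2"
  mapB' :: "'b1 \<Rightarrow> 'd1"
  mapB :: "'b \<Rightarrow> 'd"
  mapB'' :: "'b2 \<Rightarrow> 'd2"
  mapC :: "'e \<Rightarrow> 'f"

definition tate_morphism ::
  "'g top_group \<Rightarrow> ('g, 'a1, 'a, 'a2, 'b1, 'b, 'b2, 'e) tate \<Rightarrow>
   'h top_group \<Rightarrow> ('h, 'c1, 'c, 'c2, 'd1, 'd, 'd2, 'f) tate \<Rightarrow> ('h \<Rightarrow> 'g) \<Rightarrow>
   ('a1, 'c1, 'a, 'c, 'a2, 'c2, 'b1, 'd1, 'b, 'd, 'b2, 'd2, 'e, 'f) tate_maps \<Rightarrow> bool" where
  "tate_morphism G1 P1 G2 P2 \<phi> \<psi> \<longleftrightarrow>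
     profinite_hom G2 G1 \<phi> \<and>
     (\<forall>a\<in>carrier (modA' P1). mapA \<psi> (inclA P1 a) = inclA P2 (mapA' \<psi> a)) \<and>
     (\<forall>a\<in>carrier (modA P1). mapA'' \<psi> (projA P1 a) = projA P2 (mapA \<psi> a)) \<and>
     (\<forall>b\<in>carrier (modB' P1). mapB \<psi> (inclB P1 b) = inclB P2 (mapB' \<psi> b)) \<and>
     (\<forall>b\<in>carrier (modB P1). mapB'' \<psi> (projB P1 b) = projB P2 (mapB \<psi> b)) \<and>
     module_morphism G1 (modA' P1) G2 (modA' P2) \<phi> (mapA' \<psi>) \<and>
     module_morphism G1 (modA P1) G2 (modA P2) \<phi> (mapA \<psi>) \<and>
     module_morphism G1 (modA'' P1) G2 (modA'' P2) \<phi> (mapA'' \<psi>) \<and>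
     module_morphism G1 (modB' P1) G2 (modB' P2) \<phi> (mapB' \<psi>) \<and>
     module_morphism G1 (modB P1) G2 (modB P2) \<phi> (mapB \<psi>) \<and>
     module_morphism G1 (modB'' P1) G2 (modB'' P2) \<phi> (mapB'' \<psi>) \<and>
     module_morphism G1 (modC P1) G2 (modC P2) \<phi> (mapC \<psi>) \<and>
     (\<forall>a\<in>carrier (modA' P1). \<forall>b\<in>carrier (modB P1).
        mapC \<psi> (pair1 P1 a b) = pair1 P2 (mapA' \<psi> a) (mapB \<psi> b)) \<and>
     (\<forall>a\<in>carrier (modA P1). \<forall>b\<in>carrier (modB' P1).
        mapC \<psi> (pair2 P1 a b) = pair2 P2 (mapA \<psi> a) (mapB' \<psi> b))"

end

theory Submission
  imports Defs
begin

text \<open>The cohomology class of a lift-dependent cochain is controlled by two facts. Write \<open>\<partial>f\<close> for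
  \<open>d f\<close> regarded as a cochain with values in \<open>A'\<close>. First, the Leibniz rule for the two pairings
  shows that \<open>\<partial>f \<union> g + (-1)\<^sup>r f \<union> \<partial>g\<close> is a cocycle, and that it is a coboundary as soon as \<open>f\<close> or
  \<open>g\<close> is a coboundary or takes values in \<open>A'\<close> or \<open>B'\<close>. As the expression is biadditive in the lifts,
  its class depends only on the classes of \<open>j\<^sub>* f\<close> and \<open>j\<^sub>* g\<close>. Second, pulling back cochains
  commutes with coboundaries, cup products and \<open>\<partial>\<close>, and it carries lifts to lifts, so the
  augmented cup product can be compared on one pair of lifts.\<close>

section \<open>Alternating sums in abelian groups\<close>

text \<open>Both sides of the claim are definite descriptions, so a computation with one pair of
  lifts settles it only when all lifts are known to give the same class; most of the work goes into
  that. The formulas behind the vanishing are short. If \<open>f = i a\<close>, then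
  \<open>\<partial>f = d a\<close>, and since the pairings agree on \<open>A' \<times> B'\<close>
  the cochain is exactly \<open>d (a \<union> g)\<close>. If \<open>f = d h\<close>, then
  \<open>\<partial>f\<close> is trivial and what remains is, up to sign,
  \<open>d (h \<union> \<partial>g)\<close>, because \<open>d (\<partial>g)\<close> is trivial. The
  second argument is treated in the same way. One obstacle is that \<open>\<partial>f\<close> is
  defined by \<open>inv_into\<close>, which is arbitrary off the image of \<open>i\<close> and shows
  no compatibility with sums or morphisms. It is therefore pinned down by the equation
  \<open>i \<partial>f = d f\<close> and the injectivity of \<open>i\<close>. The other obstacle is
  the shape of the coboundary formula, whose outer terms look different from the inner ones.
  Rewriting it as an alternating sum of \<open>r + 2\<close> uniformly indexed faces reduces
  \<open>d d = 0\<close> and the Leibniz rule to identities between single faces.\<close>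

definition alt_sign :: "('a, 'm) ring_scheme \<Rightarrow> nat \<Rightarrow> 'a \<Rightarrow> 'a" where
  "alt_sign A n a = (if even n then a else \<ominus>\<^bsub>A\<^esub> a)"

text \<open>The bound is inclusive, so there are \<open>n + 1\<close> terms; a cochain of degree
  \<open>r\<close> has \<open>r + 2\<close> faces, and its coboundary is an
  \<open>alt_sum A (Suc r)\<close>.\<close>

definition alt_sum :: "('a, 'm) ring_scheme \<Rightarrow> nat \<Rightarrow> (nat \<Rightarrow> 'a) \<Rightarrow> 'a" where
  "alt_sum A n u = (\<Oplus>\<^bsub>A\<^esub>i\<in>{..n}. alt_sign A i (u i))"

context abelian_group
begin

lemma alt_sign_closed [simp, intro]: "a \<in> carrier G \<Longrightarrow> alt_sign G n a \<in> carrier G"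
  by (simp add: alt_sign_def)

lemma alt_sign_0 [simp]: "alt_sign G 0 a = a"
  by (simp add: alt_sign_def)

lemma alt_sign_Suc: "a \<in> carrier G \<Longrightarrow> alt_sign G (Suc n) a = \<ominus> alt_sign G n a"
  by (simp add: alt_sign_def)

lemma alt_sign_add:
  "a \<in> carrier G \<Longrightarrow> b \<in> carrier G \<Longrightarrow> alt_sign G n (a \<oplus> b) = alt_sign G n a \<oplus> alt_sign G n b"
  by (simp add: alt_sign_def minus_add)

lemma alt_sign_minus: "a \<in> carrier G \<Longrightarrow> alt_sign G n (\<ominus> a) = \<ominus> alt_sign G n a"
  by (simp add: alt_sign_def)

lemma alt_sign_alt_sign:
  "a \<in> carrier G \<Longrightarrow> alt_sign G m (alt_sign G n a) = alt_sign G (m + n) a"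
  by (simp add: alt_sign_def)

text \<open>The definitions write signs as integer powers; a parity test is easier to rewrite with,
  and this is the translation.\<close>

lemma add_pow_alt_sign:
  assumes "a \<in> carrier G"
  shows "add_pow G ((- 1 :: int) ^ n) a = alt_sign G n a"
proof (cases "even n")
  case True
  then show ?thesis using assms by (simp add: alt_sign_def add_pow_int_ge)
next
  case False
  then show ?thesis using assms by (simp add: alt_sign_def add_pow_int_lt)
qed

lemma alt_sum_closed [simp, intro]:
  "(\<And>i. i \<le> n \<Longrightarrow> u i \<in> carrier G) \<Longrightarrow> alt_sum G n u \<in> carrier G"
  by (auto simp: alt_sum_def intro!: finsum_closed)

lemma alt_sum_cong:
  assumes "\<And>i. i \<le> n \<Longrightarrow> u i = v i" "\<And>i. i \<le> n \<Longrightarrow> v i \<in> carrier G"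
  shows "alt_sum G n u = alt_sum G n v"
  unfolding alt_sum_def using assms by (intro finsum_cong') auto

lemma alt_sum_0 [simp]: "u 0 \<in> carrier G \<Longrightarrow> alt_sum G 0 u = u 0"
  by (simp add: alt_sum_def)

lemma alt_sum_Suc:
  "(\<And>i. i \<le> Suc n \<Longrightarrow> u i \<in> carrier G) \<Longrightarrow>
   alt_sum G (Suc n) u = alt_sum G n u \<oplus> alt_sign G (Suc n) (u (Suc n))"
  unfolding alt_sum_def by (subst finsum_Suc) (auto intro!: a_comm finsum_closed)

lemma alt_sum_add:
  assumes "\<And>i. i \<le> n \<Longrightarrow> u i \<in> carrier G" "\<And>i. i \<le> n \<Longrightarrow> v i \<in> carrier G"
  shows "alt_sum G n (\<lambda>i. u i \<oplus> v i) = alt_sum G n u \<oplus> alt_sum G n v"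
proof -
  have "alt_sum G n (\<lambda>i. u i \<oplus> v i) = (\<Oplus>i\<in>{..n}. alt_sign G i (u i) \<oplus> alt_sign G i (v i))"
    unfolding alt_sum_def using assms by (intro finsum_cong') (auto simp: alt_sign_add)
  also have "\<dots> = alt_sum G n u \<oplus> alt_sum G n v"
    unfolding alt_sum_def using assms by (intro finsum_addf) auto
  finally show ?thesis .
qed

text \<open>By induction on \<open>n\<close>: the terms added in the step are \<open>F j (n + 1)\<close> for \<open>j \<le> n + 1\<close> and
  \<open>F (n + 2) i\<close> for \<open>i \<le> n + 1\<close>; they agree pairwise and have opposite signs.\<close>

lemma alt_sum_alt_sum_eq_zero:
  assumes "\<And>j i. j \<le> Suc n \<Longrightarrow> i \<le> n \<Longrightarrow> F j i \<in> carrier G"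
    and "\<And>j i. i < j \<Longrightarrow> j \<le> Suc n \<Longrightarrow> F j i = F i (j - 1)"
  shows "alt_sum G (Suc n) (\<lambda>j. alt_sum G n (F j)) = \<zero>"
  using assms
proof (induction n)
  case 0
  have "F j 0 \<in> carrier G" if "j \<le> Suc 0" for j
    using 0(1) that by simp
  moreover have "F (Suc 0) 0 = F 0 0"
    using 0(2)[of 0 "Suc 0"] by simp
  ultimately show ?case
    by (simp add: alt_sum_Suc alt_sign_Suc r_neg)
next
  case (Suc n)
  have F: "F j i \<in> carrier G" if "j \<le> Suc (Suc n)" "i \<le> Suc n" for j i
    using Suc.prems(1) that by blast
  have last: "F (Suc (Suc n)) i = F i (Suc n)" if "i \<le> Suc n" for i
    using Suc.prems(2)[of i "Suc (Suc n)"] that by simp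
  have step: "alt_sum G m (\<lambda>j. alt_sign G k (u j)) = alt_sign G k (alt_sum G m u)"
    if "\<And>j. j \<le> m \<Longrightarrow> u j \<in> carrier G" for m k u
    using that
  proof (induction m)
    case (Suc m)
    then show ?case
      by (simp add: alt_sum_Suc alt_sign_add alt_sign_alt_sign add.commute)
  qed simp
  let ?T = "alt_sum G (Suc n) (\<lambda>j. F j (Suc n))"
  have T: "?T \<in> carrier G" using F by auto
  have "alt_sum G (Suc (Suc n)) (\<lambda>j. alt_sum G (Suc n) (F j)) =
    alt_sum G (Suc n) (\<lambda>j. alt_sum G n (F j) \<oplus> alt_sign G (Suc n) (F j (Suc n)))
    \<oplus> alt_sign G (Suc (Suc n)) (alt_sum G (Suc n) (F (Suc (Suc n))))"
    using F by (subst alt_sum_Suc, force) (intro arg_cong2[of _ _ _ _ "(\<oplus>)"] alt_sum_cong;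
      force simp: alt_sum_Suc)
  also have "alt_sum G (Suc n) (F (Suc (Suc n))) = ?T"
    using last F by (intro alt_sum_cong) auto
  also have "alt_sum G (Suc n) (\<lambda>j. alt_sum G n (F j) \<oplus> alt_sign G (Suc n) (F j (Suc n))) =
     alt_sign G (Suc n) ?T"
    using F Suc.IH Suc.prems(2) by (subst alt_sum_add) (auto simp: step alt_sum_closed)
  finally show ?case
    using T by (simp add: alt_sign_Suc[of _ "Suc n"] r_neg)
qed

text \<open>The sign bookkeeping of the Leibniz rule: \<open>u\<close> and \<open>v\<close> stand
  for the faces on the left and right factor, \<open>w\<close> for those of the cup product. The
  right side has two terms more than the left, \<open>u (Suc r)\<close> with sign
  \<open>(-1)^(r+1)\<close> and \<open>v 0\<close> with sign \<open>(-1)^r\<close>; they are equal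
  and cancel.\<close>

lemma alt_sum_concat:
  assumes u: "\<And>i. i \<le> Suc r \<Longrightarrow> u i \<in> carrier G"
    and v: "\<And>i. i \<le> Suc s \<Longrightarrow> v i \<in> carrier G"
    and wu: "\<And>i. i \<le> r \<Longrightarrow> w i = u i"
    and wv: "\<And>k. k \<le> s \<Longrightarrow> w (Suc (r + k)) = v (Suc k)"
    and uv: "u (Suc r) = v 0"
  shows "alt_sum G (Suc (r + s)) w =
    alt_sum G (Suc r) u \<oplus> alt_sign G r (alt_sum G (Suc s) v)"
  using v wv
proof (induction s)
  \<comment> \<open>All the cancellation happens in the base case; the induction step only appends
    one last term to both sides.\<close>
  case 0
  have w: "w i \<in> carrier G" if "i \<le> Suc r" for i
    using that wu[of i] u[of i] 0(2)[of 0] 0(1)[of "Suc 0"] by (cases "i = Suc r") auto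
  have "alt_sum G (Suc r) w = alt_sum G r u \<oplus> \<ominus> alt_sign G r (v 1)"
    using w u wu 0 by (simp add: alt_sum_Suc alt_sign_Suc cong: alt_sum_cong)
  moreover have "alt_sum G (Suc r) u = alt_sum G r u \<oplus> \<ominus> alt_sign G r (v 0)"
    using u uv 0 by (simp add: alt_sum_Suc alt_sign_Suc)
  moreover have "alt_sign G r (alt_sum G (Suc 0) v) = alt_sign G r (v 0) \<oplus> \<ominus> alt_sign G r (v 1)"
    using 0(1) by (simp add: alt_sum_Suc alt_sign_Suc alt_sign_add alt_sign_minus)
  moreover have "alt_sum G r u \<in> carrier G" "v 0 \<in> carrier G" "v 1 \<in> carrier G"
    using u 0(1) by auto
  ultimately show ?case
    by (simp add: a_assoc r_neg1)
next
  case (Suc s)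
  have w: "w i \<in> carrier G" if "i \<le> Suc (r + Suc s)" for i
  proof (cases "i \<le> r")
    case True
    then show ?thesis using wu u by simp
  next
    case False
    then have "i = Suc (r + (i - Suc r))" "i - Suc r \<le> Suc s" using that by auto
    then show ?thesis using Suc.prems(2)[of "i - Suc r"] Suc.prems(1)[of "Suc (i - Suc r)"] by auto
  qed
  have IH: "alt_sum G (Suc (r + s)) w = alt_sum G (Suc r) u \<oplus> alt_sign G r (alt_sum G (Suc s) v)"
    using Suc by simp
  have "alt_sum G (Suc (r + Suc s)) w =
     alt_sum G (Suc (r + s)) w \<oplus> alt_sign G (Suc (Suc (r + s))) (v (Suc (Suc s)))"
    using w Suc.prems(2)[of "Suc s"] by (simp add: alt_sum_Suc)
  moreover have "alt_sign G r (alt_sum G (Suc (Suc s)) v) =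
     alt_sign G r (alt_sum G (Suc s) v) \<oplus> alt_sign G (Suc (Suc (r + s))) (v (Suc (Suc s)))"
    using Suc.prems(1) by (simp add: alt_sum_Suc[of "Suc s"] alt_sign_add alt_sign_alt_sign)
  ultimately show ?case
    using u Suc.prems(1) by (simp add: IH a_assoc)
qed

end

text \<open>Used for the action of a group element, for the coefficient map of a morphism, and for a
  pairing with one argument fixed.\<close>

lemma hom_alt_sum:
  assumes "abelian_group A" "abelian_group B" "h \<in> hom (add_monoid A) (add_monoid B)"
    and "\<And>i. i \<le> n \<Longrightarrow> u i \<in> carrier A"
  shows "h (alt_sum A n u) = alt_sum B n (\<lambda>i. h (u i))"
    and "a \<in> carrier A \<Longrightarrow> h (alt_sign A n a) = alt_sign B n (h a)"
proof -
  interpret A: abelian_group A by fact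
  interpret B: abelian_group B by fact
  interpret h: abelian_group_hom A B h
    using assms by (simp add: abelian_group_hom_def abelian_group_hom_axioms_def group_hom_def
      group_hom_axioms_def A.a_group B.a_group)
  show sign: "h (alt_sign A m a) = alt_sign B m (h a)" if "a \<in> carrier A" for m a
    using that by (simp add: alt_sign_def)
  show "h (alt_sum A n u) = alt_sum B n (\<lambda>i. h (u i))"
    using assms(4) by (induction n) (simp_all add: A.alt_sum_Suc B.alt_sum_Suc sign)
qed

section \<open>The cochain complex of a discrete module\<close>

abbreviation tuple_top :: "'g top_group \<Rightarrow> nat \<Rightarrow> (nat \<Rightarrow> 'g) topology" where
  "tuple_top G r \<equiv> product_topology (\<lambda>_. group_top G) {..<r}"

lemma tuples_component: "x \<in> tuples G r \<Longrightarrow> k < r \<Longrightarrow> x k \<in> carrier G"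
  by (auto simp: tuples_def)

lemma restrict_tuples: "x \<in> tuples G (r + s) \<Longrightarrow> restrict x {..<r} \<in> tuples G r"
  by (simp add: tuples_def PiE_iff)

lemma shift_tuples: "x \<in> tuples G (r + s) \<Longrightarrow> (\<lambda>k\<in>{..<s}. x (r + k)) \<in> tuples G s"
  by (simp add: tuples_def PiE_iff)

text \<open>A product of two discrete spaces is discrete, so any operation on it that lands in
  \<open>U\<close> is continuous. Additions and pairings of cochains are continuous for this
  reason.\<close>

lemma continuous_map_discrete2:
  assumes "continuous_map Y (discrete_topology S) f" "continuous_map Y (discrete_topology T) g"
    and "\<And>a b. a \<in> S \<Longrightarrow> b \<in> T \<Longrightarrow> h a b \<in> U"
  shows "continuous_map Y (discrete_topology U) (\<lambda>x. h (f x) (g x))"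
proof -
  have "continuous_map Y (discrete_topology (Sigma S (\<lambda>_. T))) (\<lambda>x. (f x, g x))"
    using assms by (simp add: prod_topology_discrete_topology continuous_map_paired)
  moreover have "continuous_map (discrete_topology (Sigma S (\<lambda>_. T))) (discrete_topology U) (\<lambda>(a, b). h a b)"
    using assms(3) by auto
  ultimately show ?thesis
    using continuous_map_compose[of Y _ "\<lambda>x. (f x, g x)" _ "\<lambda>(a, b). h a b"] by (simp add: o_def)
qed

lemma continuous_map_discrete1:
  assumes "continuous_map Y (discrete_topology S) f" "\<And>a. a \<in> S \<Longrightarrow> h a \<in> U"
  shows "continuous_map Y (discrete_topology U) (\<lambda>x. h (f x))"
  using continuous_map_discrete2[OF assms(1,1), of "\<lambda>a b. h a" U] assms(2) by simp

lemma continuous_map_tuple_component: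
  "k < r \<Longrightarrow> continuous_map (tuple_top G r) (group_top G) (\<lambda>x. x k)"
  by (rule continuous_map_product_projection) simp

lemma continuous_map_into_tuple_top:
  assumes "\<And>k. k < s \<Longrightarrow> continuous_map Y (group_top G) (\<lambda>x. F x k)"
  shows "continuous_map Y (tuple_top G s) (\<lambda>x. \<lambda>k\<in>{..<s}. F x k)"
  using assms by (auto simp: continuous_map_componentwise)

locale profinite_top_group =
  fixes G :: "'g top_group"
  assumes profinite: "profinite_group G"
begin

sublocale grp: group G
  using profinite by (simp add: profinite_group_def)

lemma topspace_group_top [simp]: "topspace (group_top G) = carrier G"
  using profinite by (simp add: profinite_group_def)

lemma PiE_carrier [simp]: "{..<r} \<rightarrow>\<^sub>E carrier G = tuples G r"
  by (simp add: tuples_def)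

lemma continuous_map_mult:
  assumes "continuous_map Y (group_top G) f" "continuous_map Y (group_top G) g"
  shows "continuous_map Y (group_top G) (\<lambda>x. f x \<otimes>\<^bsub>G\<^esub> g x)"
proof -
  have "continuous_map Y (prod_topology (group_top G) (group_top G)) (\<lambda>x. (f x, g x))"
    using assms by (simp add: continuous_map_paired)
  moreover have "continuous_map (prod_topology (group_top G) (group_top G)) (group_top G)
      (\<lambda>(x, y). x \<otimes>\<^bsub>G\<^esub> y)"
    using profinite by (simp add: profinite_group_def)
  ultimately show ?thesis
    using continuous_map_compose[of Y _ "\<lambda>x. (f x, g x)" _ "\<lambda>(x, y). x \<otimes>\<^bsub>G\<^esub> y"]
    by (simp add: o_def)
qed

lemma merge_at_tuples: "x \<in> tuples G (Suc r) \<Longrightarrow> merge_at G r i x \<in> tuples G r"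
  by (simp add: tuples_def merge_at_def PiE_iff del: PiE_carrier)

text \<open>Outside the intended range \<open>1..r\<close> the formula of \<open>merge_at\<close>
  still yields the two outer tuples of the coboundary: index \<open>0\<close> falls into its last
  branch throughout, index \<open>r + 1\<close> into its first. This allows a uniform indexing of
  the faces.\<close>

lemma merge_at_0: "merge_at G r 0 x = (\<lambda>k\<in>{..<r}. x (Suc k))"
  by (auto simp: merge_at_def)

lemma merge_at_last: "merge_at G r (Suc r) x = restrict x {..<r}"
  by (auto simp: merge_at_def)

text \<open>The simplicial identity of the bar construction. When \<open>j = i + 1\<close> and
  \<open>i > 0\<close>, three neighbouring entries are multiplied and associativity is what makes
  both orders agree.\<close>

lemma merge_at_merge_at:
  assumes "i < j" "x \<in> tuples G (Suc (Suc r))"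
  shows "merge_at G r i (merge_at G (Suc r) j x) = merge_at G r (j - 1) (merge_at G (Suc r) i x)"
proof
  fix k
  show "merge_at G r i (merge_at G (Suc r) j x) k =
      merge_at G r (j - 1) (merge_at G (Suc r) i x) k"
  proof (cases "k < r")
    case True
    then have "x k \<in> carrier G" "x (Suc k) \<in> carrier G" "x (Suc (Suc k)) \<in> carrier G"
      using assms(2) by (auto intro: tuples_component)
    with True assms(1) show ?thesis
      by (auto simp: merge_at_def grp.m_assoc)
  qed (simp add: merge_at_def)
qed

lemma continuous_map_merge_at:
  "continuous_map (tuple_top G (Suc r)) (tuple_top G r) (merge_at G r i)"
proof -
  have "continuous_map (tuple_top G (Suc r)) (group_top G)
     (\<lambda>x. if Suc k < i then x k else if Suc k = i then x k \<otimes>\<^bsub>G\<^esub> x (Suc k) else x (Suc k))"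
    if "k < r" for k
    using that by (auto intro!: continuous_map_mult continuous_map_tuple_component)
  from continuous_map_into_tuple_top[OF this] show ?thesis
    by (simp add: merge_at_def[abs_def])
qed

end

text \<open>The coface operators of the inhomogeneous bar complex. Only the one with index
  \<open>0\<close> involves the action.\<close>

definition face ::
  "'g top_group \<Rightarrow> ('g, 'a) module \<Rightarrow> nat \<Rightarrow> nat \<Rightarrow> ((nat \<Rightarrow> 'g) \<Rightarrow> 'a) \<Rightarrow> (nat \<Rightarrow> 'g) \<Rightarrow> 'a" where
  "face G A r i f x =
     (if i = 0 then x 0 \<odot>\<^bsub>A\<^esub> f (merge_at G r 0 x) else f (merge_at G r i x))"

locale discrete_gmodule = profinite_top_group G
  for G :: "'g top_group" and A :: "('g, 'a) module" +
  assumes discrete: "discrete_module G A"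
begin

sublocale mdl: abelian_group A
  using discrete by (simp add: discrete_module_def)

lemma act_closed [simp]: "g \<in> carrier G \<Longrightarrow> a \<in> carrier A \<Longrightarrow> g \<odot>\<^bsub>A\<^esub> a \<in> carrier A"
  using discrete by (simp add: discrete_module_def)

lemma act_mult:
  "g \<in> carrier G \<Longrightarrow> h \<in> carrier G \<Longrightarrow> a \<in> carrier A \<Longrightarrow>
   (g \<otimes>\<^bsub>G\<^esub> h) \<odot>\<^bsub>A\<^esub> a = g \<odot>\<^bsub>A\<^esub> (h \<odot>\<^bsub>A\<^esub> a)"
  using discrete by (simp add: discrete_module_def)

lemma act_add:
  "g \<in> carrier G \<Longrightarrow> a \<in> carrier A \<Longrightarrow> b \<in> carrier A \<Longrightarrow>
   g \<odot>\<^bsub>A\<^esub> (a \<oplus>\<^bsub>A\<^esub> b) = g \<odot>\<^bsub>A\<^esub> a \<oplus>\<^bsub>A\<^esub> g \<odot>\<^bsub>A\<^esub> b"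
  using discrete by (simp add: discrete_module_def)

lemma act_hom: "g \<in> carrier G \<Longrightarrow> (\<lambda>a. g \<odot>\<^bsub>A\<^esub> a) \<in> hom (add_monoid A) (add_monoid A)"
  by (auto simp: hom_def act_add)

lemma continuous_map_act:
  assumes "continuous_map Y (group_top G) u" "continuous_map Y (discrete_topology (carrier A)) f"
  shows "continuous_map Y (discrete_topology (carrier A)) (\<lambda>x. u x \<odot>\<^bsub>A\<^esub> f x)"
proof -
  have "continuous_map Y (prod_topology (group_top G) (discrete_topology (carrier A)))
      (\<lambda>x. (u x, f x))"
    using assms by (simp add: continuous_map_paired)
  moreover have "continuous_map (prod_topology (group_top G) (discrete_topology (carrier A)))
      (discrete_topology (carrier A)) (\<lambda>(g, a). g \<odot>\<^bsub>A\<^esub> a)"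
    using discrete by (simp add: discrete_module_def)
  ultimately show ?thesis
    using continuous_map_compose[of Y _ "\<lambda>x. (u x, f x)" _ "\<lambda>(g, a). g \<odot>\<^bsub>A\<^esub> a"]
    by (simp add: o_def)
qed

abbreviation C :: "nat \<Rightarrow> ((nat \<Rightarrow> 'g) \<Rightarrow> 'a) monoid" where
  "C r \<equiv> cochains G A r"

abbreviation d :: "nat \<Rightarrow> ((nat \<Rightarrow> 'g) \<Rightarrow> 'a) \<Rightarrow> (nat \<Rightarrow> 'g) \<Rightarrow> 'a" where
  "d \<equiv> coboundary G A"

lemma cochain_continuous:
  "f \<in> carrier (C r) \<Longrightarrow> continuous_map (tuple_top G r) (discrete_topology (carrier A)) f"
  by (simp add: cochains_def)

lemma cochain_closed: "f \<in> carrier (C r) \<Longrightarrow> x \<in> tuples G r \<Longrightarrow> f x \<in> carrier A"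
  using continuous_map_funspace[OF cochain_continuous[of f r]] by auto

lemma cochain_eqI:
  "f \<in> carrier (C r) \<Longrightarrow> g \<in> carrier (C r) \<Longrightarrow> (\<And>x. x \<in> tuples G r \<Longrightarrow> f x = g x) \<Longrightarrow> f = g"
  by (auto simp: cochains_def intro: extensionalityI)

lemma restrict_cochain:
  assumes "continuous_map (tuple_top G r) (discrete_topology (carrier A)) f"
  shows "restrict f (tuples G r) \<in> carrier (C r)"
  using continuous_map_eq[OF assms, of "restrict f (tuples G r)"] by (auto simp: cochains_def)

lemma cochain_mult: "x \<in> tuples G r \<Longrightarrow> (f \<otimes>\<^bsub>C r\<^esub> g) x = f x \<oplus>\<^bsub>A\<^esub> g x"
  by (simp add: cochains_def)

lemma cochain_one: "x \<in> tuples G r \<Longrightarrow> \<one>\<^bsub>C r\<^esub> x = \<zero>\<^bsub>A\<^esub>"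
  by (simp add: cochains_def)

lemma cochain_mult_closed:
  assumes "f \<in> carrier (C r)" "g \<in> carrier (C r)"
  shows "f \<otimes>\<^bsub>C r\<^esub> g \<in> carrier (C r)"
  using restrict_cochain[OF continuous_map_discrete2[OF
    cochain_continuous[OF assms(1)] cochain_continuous[OF assms(2)], of "\<lambda>a b. a \<oplus>\<^bsub>A\<^esub> b"]]
  by (simp add: cochains_def)

lemma cochain_one_closed: "\<one>\<^bsub>C r\<^esub> \<in> carrier (C r)"
  using restrict_cochain[of r "\<lambda>_. \<zero>\<^bsub>A\<^esub>"] by (simp add: cochains_def)

lemma cochain_minus_closed:
  assumes "f \<in> carrier (C r)"
  shows "(\<lambda>x\<in>tuples G r. \<ominus>\<^bsub>A\<^esub> f x) \<in> carrier (C r)"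
  using restrict_cochain[OF continuous_map_discrete1[OF
    cochain_continuous[OF assms(1)], of "\<lambda>a. \<ominus>\<^bsub>A\<^esub> a"]] by simp

lemma cochains_comm_group: "comm_group (C r)"
proof (rule comm_groupI)
  fix f g h assume fgh: "f \<in> carrier (C r)" "g \<in> carrier (C r)" "h \<in> carrier (C r)"
  show "f \<otimes>\<^bsub>C r\<^esub> g \<otimes>\<^bsub>C r\<^esub> h = f \<otimes>\<^bsub>C r\<^esub> (g \<otimes>\<^bsub>C r\<^esub> h)"
    using fgh by (intro cochain_eqI[of _ r])
      (auto simp: cochain_mult_closed cochain_mult cochain_closed mdl.a_assoc)
next
  fix f g assume fg: "f \<in> carrier (C r)" "g \<in> carrier (C r)"
  show "f \<otimes>\<^bsub>C r\<^esub> g = g \<otimes>\<^bsub>C r\<^esub> f"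
    using fg by (intro cochain_eqI[of _ r])
      (auto simp: cochain_mult_closed cochain_mult cochain_closed mdl.a_comm)
next
  fix f assume f: "f \<in> carrier (C r)"
  show "\<one>\<^bsub>C r\<^esub> \<otimes>\<^bsub>C r\<^esub> f = f"
    using f by (intro cochain_eqI[of _ r])
      (auto simp: cochain_mult_closed cochain_mult cochain_closed cochain_one_closed cochain_one)
  have "(\<lambda>x\<in>tuples G r. \<ominus>\<^bsub>A\<^esub> f x) \<otimes>\<^bsub>C r\<^esub> f = \<one>\<^bsub>C r\<^esub>"
    using f by (intro cochain_eqI[of _ r])
      (auto simp: cochain_mult_closed cochain_mult cochain_closed cochain_one_closed cochain_one
        cochain_minus_closed mdl.l_neg)
  with cochain_minus_closed[OF f] show "\<exists>g\<in>carrier (C r). g \<otimes>\<^bsub>C r\<^esub> f = \<one>\<^bsub>C r\<^esub>" by blast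
qed (auto simp: cochain_mult_closed cochain_one_closed)

sublocale cc: comm_group "cochains G A r" for r
  by (rule cochains_comm_group)

lemma eval_hom: "x \<in> tuples G r \<Longrightarrow> (\<lambda>f. f x) \<in> hom (C r) (add_monoid A)"
  by (simp add: hom_def cochain_closed cochain_mult)

text \<open>Evaluation at a tuple is a homomorphism from the multiplicatively written cochain group
  to the additive group of \<open>A\<close>, hence turns powers into multiples.\<close>

lemma cochain_int_pow:
  "f \<in> carrier (C r) \<Longrightarrow> x \<in> tuples G r \<Longrightarrow> (f [^]\<^bsub>C r\<^esub> (k :: int)) x = add_pow A k (f x)"
  using group_hom.hom_int_pow[of "C r" "add_monoid A" "\<lambda>f. f x" f k] eval_hom[of x r]
  by (simp add: group_hom_def group_hom_axioms_def mdl.a_group add_pow_def)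

lemma cochain_sign:
  "f \<in> carrier (C r) \<Longrightarrow> x \<in> tuples G r \<Longrightarrow>
   (f [^]\<^bsub>C r\<^esub> ((- 1 :: int) ^ n)) x = alt_sign A n (f x)"
  by (simp add: cochain_int_pow mdl.add_pow_alt_sign cochain_closed)

section \<open>The coboundary as an alternating sum of faces, and \<open>d d = 0\<close>\<close>

lemma face_closed:
  assumes "f \<in> carrier (C r)" "x \<in> tuples G (Suc r)"
  shows "face G A r i f x \<in> carrier A"
  using cochain_closed[OF assms(1) merge_at_tuples[OF assms(2)]] tuples_component[OF assms(2), of 0]
  by (simp add: face_def)

lemma face_continuous:
  assumes "f \<in> carrier (C r)"
  shows "continuous_map (tuple_top G (Suc r)) (discrete_topology (carrier A)) (face G A r i f)"
proof -
  have "continuous_map (tuple_top G (Suc r)) (discrete_topology (carrier A))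
      (\<lambda>x. f (merge_at G r i x))" for i
    using continuous_map_compose[OF continuous_map_merge_at cochain_continuous[OF assms]]
    by (simp add: o_def)
  then show ?thesis
    using continuous_map_act[OF continuous_map_tuple_component[of 0 "Suc r" G]]
    by (cases "i = 0") (simp_all add: face_def[abs_def])
qed

text \<open>The normal form in which values of coboundaries are computed from here on: the two outer
  terms of the defining formula become the faces \<open>0\<close> and \<open>r + 1\<close>.\<close>

lemma coboundary_eq_alt_sum:
  assumes f: "f \<in> carrier (C r)" and x: "x \<in> tuples G (Suc r)"
  shows "d r f x = alt_sum A (Suc r) (\<lambda>i. face G A r i f x)"
proof -
  have closed: "face G A r i f x \<in> carrier A" "f (merge_at G r i x) \<in> carrier A" for i
    using face_closed[OF f x] cochain_closed[OF f merge_at_tuples[OF x]] by auto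
  have "alt_sum A r (\<lambda>i. face G A r i f x) = (\<Oplus>\<^bsub>A\<^esub>i\<in>insert 0 {1..r}. alt_sign A i (face G A r i f x))"
    by (auto simp: alt_sum_def intro: arg_cong[of _ _ "finsum A _"])
  also have "\<dots> = face G A r 0 f x \<oplus>\<^bsub>A\<^esub> (\<Oplus>\<^bsub>A\<^esub>i\<in>{1..r}. alt_sign A i (face G A r i f x))"
    using closed by (subst mdl.finsum_insert) auto
  also have "(\<Oplus>\<^bsub>A\<^esub>i\<in>{1..r}. alt_sign A i (face G A r i f x)) =
      (\<Oplus>\<^bsub>A\<^esub>i\<in>{1..r}. add_pow A ((- 1 :: int) ^ i) (f (merge_at G r i x)))"
    using closed by (intro mdl.finsum_cong') (auto simp: face_def mdl.add_pow_alt_sign)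
  finally have *: "alt_sum A r (\<lambda>i. face G A r i f x) = face G A r 0 f x \<oplus>\<^bsub>A\<^esub> \<dots>" .
  have "d r f x = face G A r 0 f x \<oplus>\<^bsub>A\<^esub>
      (\<Oplus>\<^bsub>A\<^esub>i\<in>{1..r}. add_pow A ((- 1 :: int) ^ i) (f (merge_at G r i x))) \<oplus>\<^bsub>A\<^esub>
      add_pow A ((- 1 :: int) ^ Suc r) (f (merge_at G r (Suc r) x))"
    using x by (simp add: coboundary_def face_def merge_at_0 merge_at_last)
  also have "\<dots> = alt_sum A r (\<lambda>i. face G A r i f x) \<oplus>\<^bsub>A\<^esub>
      alt_sign A (Suc r) (face G A r (Suc r) f x)"
    by (simp only: * mdl.add_pow_alt_sign closed) (simp add: face_def)
  also have "\<dots> = alt_sum A (Suc r) (\<lambda>i. face G A r i f x)"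
    using closed by (simp add: mdl.alt_sum_Suc)
  finally show ?thesis .
qed

lemma coboundary_closed:
  assumes f: "f \<in> carrier (C r)"
  shows "d r f \<in> carrier (C (Suc r))"
proof -
  \<comment> \<open>The number of terms is decoupled from the degree \<open>r\<close>, so that an
    induction can add one continuous face at a time.\<close>
  have "continuous_map (tuple_top G (Suc r)) (discrete_topology (carrier A))
      (\<lambda>x. alt_sum A m (\<lambda>i. face G A r i f x))" for m
  proof (induction m)
    case 0
    show ?case
      by (rule continuous_map_eq[OF face_continuous[OF f, of 0]])
        (simp add: face_closed[OF f])
  next
    case (Suc m)
    show ?case
      by (rule continuous_map_eq[OF continuous_map_discrete2[OF Suc face_continuous[OF f, of "Suc m"],
            of "\<lambda>a b. a \<oplus>\<^bsub>A\<^esub> alt_sign A (Suc m) b"]])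
        (simp_all add: mdl.alt_sum_Suc face_closed[OF f])
  qed
  moreover have "d r f = restrict (\<lambda>x. alt_sum A (Suc r) (\<lambda>i. face G A r i f x)) (tuples G (Suc r))"
    using coboundary_eq_alt_sum[OF f] by (auto simp: coboundary_def fun_eq_iff)
  ultimately show ?thesis
    using restrict_cochain by metis
qed

lemma coboundary_hom: "d r \<in> hom (C r) (C (Suc r))"
proof (rule homI)
  fix f g assume fg: "f \<in> carrier (C r)" "g \<in> carrier (C r)"
  show "d r (f \<otimes>\<^bsub>C r\<^esub> g) = d r f \<otimes>\<^bsub>C (Suc r)\<^esub> d r g"
  proof (rule cochain_eqI[of _ "Suc r"])
    fix x assume x: "x \<in> tuples G (Suc r)"
    have face: "face G A r i (f \<otimes>\<^bsub>C r\<^esub> g) x = face G A r i f x \<oplus>\<^bsub>A\<^esub> face G A r i g x" for i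
      using merge_at_tuples[OF x] tuples_component[OF x, of 0]
      by (simp add: face_def cochain_mult act_add cochain_closed[OF fg(1)] cochain_closed[OF fg(2)])
    show "d r (f \<otimes>\<^bsub>C r\<^esub> g) x = (d r f \<otimes>\<^bsub>C (Suc r)\<^esub> d r g) x"
      using fg x by (simp add: coboundary_eq_alt_sum cochain_mult face mdl.alt_sum_add face_closed)
  qed (use fg in \<open>auto simp: coboundary_closed\<close>)
qed (rule coboundary_closed)

sublocale cob: group_hom "cochains G A r" "cochains G A (Suc r)" "coboundary G A r" for r
  by unfold_locales (rule coboundary_hom)

text \<open>For \<open>i > 0\<close> this is the identity for \<open>merge_at\<close>. For
  \<open>i = 0\<close> and \<open>j = 1\<close> one side acts by the product of the first two
  entries and the other by one after the other. For \<open>i = 0\<close> and \<open>j > 1\<close>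
  the inner merge leaves the acting first entry alone.\<close>

lemma face_face:
  assumes f: "f \<in> carrier (C r)" and x: "x \<in> tuples G (Suc (Suc r))" and ij: "i < j"
  shows "face G A (Suc r) j (face G A r i f) x = face G A (Suc r) i (face G A r (j - 1) f) x"
proof -
  note comm = merge_at_merge_at[OF ij x]
  have fm: "f (merge_at G r k (merge_at G (Suc r) l x)) \<in> carrier A" for k l
    by (intro cochain_closed[OF f] merge_at_tuples x)
  consider "i > 0" | "i = 0" "j = 1" | "i = 0" "j > 1" using ij by linarith
  then show ?thesis
  proof cases
    case 1
    then show ?thesis using comm ij by (simp add: face_def)
  next
    case 2
    have "x 0 \<in> carrier G" "x 1 \<in> carrier G" using x by (auto intro: tuples_component)
    moreover have "merge_at G (Suc r) 1 x 0 = x 0 \<otimes>\<^bsub>G\<^esub> x 1" "merge_at G (Suc r) 0 x 0 = x 1"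
      by (simp_all add: merge_at_def)
    ultimately show ?thesis
      using comm 2 fm[of 0 0] by (simp add: face_def act_mult)
  next
    case 3
    then have "merge_at G (Suc r) j x 0 = x 0" by (simp add: merge_at_def)
    then show ?thesis using comm 3 by (simp add: face_def)
  qed
qed

lemma coboundary_coboundary:
  assumes f: "f \<in> carrier (C r)"
  shows "d (Suc r) (d r f) = \<one>\<^bsub>C (Suc (Suc r))\<^esub>"
proof (rule cochain_eqI[of _ "Suc (Suc r)"])
  fix x assume x: "x \<in> tuples G (Suc (Suc r))"
  define F where "F j i = face G A (Suc r) j (face G A r i f) x" for j i
  have closed: "face G A r i f (merge_at G (Suc r) j x) \<in> carrier A" for i j
    using face_closed[OF f merge_at_tuples[OF x]] .
  have "face G A (Suc r) j (d r f) x = alt_sum A (Suc r) (F j)" for j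
  proof -
    have *: "d r f (merge_at G (Suc r) j x) =
        alt_sum A (Suc r) (\<lambda>i. face G A r i f (merge_at G (Suc r) j x))"
      by (rule coboundary_eq_alt_sum[OF f merge_at_tuples[OF x]])
    show ?thesis
    \<comment> \<open>Only for the outer face \<open>0\<close> is there an action in front of the
      inner sum; it is moved inside because it is additive.\<close>
    proof (cases "j = 0")
      case True
      then show ?thesis
        using * closed hom_alt_sum(1)[OF mdl.abelian_group_axioms mdl.abelian_group_axioms
            act_hom[OF tuples_component[OF x, of 0]]]
        by (simp add: face_def[of _ _ "Suc r"] F_def[abs_def])
    next
      case False
      with * show ?thesis by (simp add: face_def[of _ _ "Suc r"] F_def[abs_def])
    qed
  qed
  then have "d (Suc r) (d r f) x = alt_sum A (Suc (Suc r)) (\<lambda>j. alt_sum A (Suc r) (F j))"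
    using coboundary_eq_alt_sum[OF coboundary_closed[OF f] x] by simp
  also have "\<dots> = \<zero>\<^bsub>A\<^esub>"
  proof (rule mdl.alt_sum_alt_sum_eq_zero)
    show "F j i \<in> carrier A" for i j
      using closed[of i j] closed[of i 0] tuples_component[OF x, of 0] by (auto simp: F_def face_def[of _ _ "Suc r"])
    show "F j i = F i (j - 1)" if "i < j" for i j
      unfolding F_def by (rule face_face[OF f x that])
  qed
  finally show "d (Suc r) (d r f) x = \<one>\<^bsub>C (Suc (Suc r))\<^esub> x"
    using x by (simp add: cochain_one)
qed (auto simp: coboundary_closed f)

section \<open>Cocycles, coboundaries and cohomology classes\<close>

lemma cocycles_iff: "f \<in> cocycles G A r \<longleftrightarrow> f \<in> carrier (C r) \<and> d r f = \<one>\<^bsub>C (Suc r)\<^esub>"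
  by (simp add: cocycles_def kernel_def)

lemma subgroup_cocycles: "subgroup (cocycles G A r) (C r)"
  unfolding cocycles_def by (rule cob.subgroup_kernel)

lemma subgroup_coboundaries: "subgroup (coboundaries G A r) (C r)"
  by (cases r) (auto simp: coboundaries_def cc.triv_subgroup cob.img_is_subgroup)

lemma coboundary_in_coboundaries:
  "f \<in> carrier (C r) \<Longrightarrow> d r f \<in> coboundaries G A (Suc r)"
  by (simp add: coboundaries_def)

lemma coboundaries_subset_cocycles: "coboundaries G A r \<subseteq> cocycles G A r"
  by (cases r) (auto simp: coboundaries_def cocycles_iff coboundary_closed coboundary_coboundary)

lemma cohom_class_eqI:
  assumes "b \<in> coboundaries G A r" "f \<in> carrier (C r)"
  shows "cohom_class G A r (b \<otimes>\<^bsub>C r\<^esub> f) = cohom_class G A r f"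
  using cc.repr_independence[OF _ assms(2) subgroup_coboundaries, of "b \<otimes>\<^bsub>C r\<^esub> f"] assms(1)
  by (auto simp: cohom_class_def r_coset_def)

lemma cohom_class_eqD:
  assumes "cohom_class G A r f = cohom_class G A r g" "f \<in> carrier (C r)"
  obtains b where "b \<in> coboundaries G A r" "f = b \<otimes>\<^bsub>C r\<^esub> g"
  using cc.rcos_self[OF assms(2) subgroup_coboundaries] assms(1)
  by (auto simp: cohom_class_def r_coset_def)

lemma cohomology_rep:
  assumes "\<alpha> \<in> carrier (cohomology G A r)"
  obtains f where "f \<in> cocycles G A r" "\<alpha> = cohom_class G A r f"
  using assms by (auto simp: cohomology_def FactGroup_def RCOSETS_def r_coset_def cohom_class_def)

end

section \<open>Functoriality of the cochain complex\<close>

text \<open>Tuples are extensional, so relabelling them by the identity changes nothing.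
  Homomorphisms over a fixed group thus become the case \<open>\<phi> = id\<close> of a morphism and
  inherit everything proved for pullbacks.\<close>

lemma push_cochain_eq_pull_cochain: "push_cochain G h r f = pull_cochain G id h r f"
  unfolding push_cochain_def pull_cochain_def
  by (intro restrict_ext) (simp add: tuples_def PiE_def extensional_restrict)

locale gmodule_morphism =
  src: discrete_gmodule G1 A1 + tgt: discrete_gmodule G2 A2
  for G1 :: "'g1 top_group" and A1 :: "('g1, 'a1) module"
    and G2 :: "'g2 top_group" and A2 :: "('g2, 'a2) module" +
  fixes \<phi> :: "'g2 \<Rightarrow> 'g1" and \<psi> :: "'a1 \<Rightarrow> 'a2"
  assumes morphism: "module_morphism G1 A1 G2 A2 \<phi> \<psi>"
begin

abbreviation pull :: "nat \<Rightarrow> ((nat \<Rightarrow> 'g1) \<Rightarrow> 'a1) \<Rightarrow> (nat \<Rightarrow> 'g2) \<Rightarrow> 'a2" where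
  "pull \<equiv> pull_cochain G2 \<phi> \<psi>"

lemma profinite_hom: "profinite_hom G2 G1 \<phi>"
  using morphism by (simp add: module_morphism_def)

lemma \<phi>_closed: "g \<in> carrier G2 \<Longrightarrow> \<phi> g \<in> carrier G1"
  using profinite_hom by (auto simp: profinite_hom_def hom_def)

lemma \<phi>_mult:
  "g \<in> carrier G2 \<Longrightarrow> h \<in> carrier G2 \<Longrightarrow> \<phi> (g \<otimes>\<^bsub>G2\<^esub> h) = \<phi> g \<otimes>\<^bsub>G1\<^esub> \<phi> h"
  using profinite_hom by (auto simp: profinite_hom_def hom_def)

lemma \<psi>_hom: "\<psi> \<in> hom (add_monoid A1) (add_monoid A2)"
  using morphism by (simp add: module_morphism_def)

lemma \<psi>_closed: "a \<in> carrier A1 \<Longrightarrow> \<psi> a \<in> carrier A2"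
  using \<psi>_hom by (auto simp: hom_def)

lemma \<psi>_add:
  "a \<in> carrier A1 \<Longrightarrow> b \<in> carrier A1 \<Longrightarrow> \<psi> (a \<oplus>\<^bsub>A1\<^esub> b) = \<psi> a \<oplus>\<^bsub>A2\<^esub> \<psi> b"
  using \<psi>_hom by (auto simp: hom_def)

lemma \<psi>_act:
  "g \<in> carrier G2 \<Longrightarrow> a \<in> carrier A1 \<Longrightarrow> \<psi> (\<phi> g \<odot>\<^bsub>A1\<^esub> a) = g \<odot>\<^bsub>A2\<^esub> \<psi> a"
  using morphism by (simp add: module_morphism_def)

lemma map_tuple: "x \<in> tuples G2 r \<Longrightarrow> (\<lambda>k\<in>{..<r}. \<phi> (x k)) \<in> tuples G1 r"
  by (simp add: tuples_def PiE_iff \<phi>_closed del: src.PiE_carrier tgt.PiE_carrier)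

lemma pull_closed:
  assumes "f \<in> carrier (src.C r)"
  shows "pull r f \<in> carrier (tgt.C r)"
proof -
  have "continuous_map (tuple_top G2 r) (group_top G1) (\<lambda>x. \<phi> (x k))" if "k < r" for k
    using continuous_map_compose[OF continuous_map_tuple_component[OF that]] profinite_hom
    by (auto simp: profinite_hom_def o_def)
  then have "continuous_map (tuple_top G2 r) (tuple_top G1 r) (\<lambda>x. \<lambda>k\<in>{..<r}. \<phi> (x k))"
    by (rule continuous_map_into_tuple_top)
  from continuous_map_compose[OF this src.cochain_continuous[OF assms]]
  have "continuous_map (tuple_top G2 r) (discrete_topology (carrier A1))
      (\<lambda>x. f (\<lambda>k\<in>{..<r}. \<phi> (x k)))"
    by (simp add: o_def)
  from tgt.restrict_cochain[OF continuous_map_discrete1[OF this \<psi>_closed]] show ?thesis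
    by (simp add: pull_cochain_def)
qed

lemma pull_apply: "x \<in> tuples G2 r \<Longrightarrow> pull r f x = \<psi> (f (\<lambda>k\<in>{..<r}. \<phi> (x k)))"
  by (simp add: pull_cochain_def)

lemma pull_hom: "pull r \<in> hom (src.C r) (tgt.C r)"
proof (rule homI)
  fix f g assume fg: "f \<in> carrier (src.C r)" "g \<in> carrier (src.C r)"
  show "pull r (f \<otimes>\<^bsub>src.C r\<^esub> g) = pull r f \<otimes>\<^bsub>tgt.C r\<^esub> pull r g"
    using fg by (intro tgt.cochain_eqI[of _ r]) (auto simp: pull_closed pull_apply tgt.cochain_mult
      src.cochain_mult map_tuple \<psi>_add src.cochain_closed)
qed (rule pull_closed)

sublocale pul: group_hom "cochains G1 A1 r" "cochains G2 A2 r" "pull_cochain G2 \<phi> \<psi> r" for r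
  by unfold_locales (rule pull_hom)

lemma map_merge_at:
  assumes "x \<in> tuples G2 (Suc r)"
  shows "merge_at G1 r i (\<lambda>k\<in>{..<Suc r}. \<phi> (x k)) = (\<lambda>k\<in>{..<r}. \<phi> (merge_at G2 r i x k))"
proof
  fix k
  show "merge_at G1 r i (\<lambda>k\<in>{..<Suc r}. \<phi> (x k)) k = (\<lambda>k\<in>{..<r}. \<phi> (merge_at G2 r i x k)) k"
    using tuples_component[OF assms, of k] tuples_component[OF assms, of "Suc k"]
    by (auto simp: merge_at_def \<phi>_mult)
qed

text \<open>The comparison is made face by face: multiplicativity of \<open>\<phi>\<close> handles
  the merged entries, compatibility of \<open>\<psi>\<close> with the actions handles the face
  \<open>0\<close>, and additivity of \<open>\<psi>\<close> passes to the sum.\<close>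

lemma pull_coboundary:
  assumes f: "f \<in> carrier (src.C r)"
  shows "tgt.d r (pull r f) = pull (Suc r) (src.d r f)"
proof (rule tgt.cochain_eqI[of _ "Suc r"])
  fix x assume x: "x \<in> tuples G2 (Suc r)"
  define y where "y = (\<lambda>k\<in>{..<Suc r}. \<phi> (x k))"
  have y: "y \<in> tuples G1 (Suc r)"
    unfolding y_def by (rule map_tuple[OF x])
  have x0: "x 0 \<in> carrier G2" and y0: "y 0 = \<phi> (x 0)"
    using tuples_component[OF x, of 0] by (auto simp: y_def)
  have "pull r f (merge_at G2 r i x) = \<psi> (f (merge_at G1 r i y))" for i
    unfolding y_def using map_merge_at[OF x] by (simp add: pull_apply tgt.merge_at_tuples[OF x])
  then have "face G2 A2 r i (pull r f) x = \<psi> (face G1 A1 r i f y)" for i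
    using src.cochain_closed[OF f src.merge_at_tuples[OF y]] x0 y0 by (simp add: face_def \<psi>_act)
  then have "tgt.d r (pull r f) x = alt_sum A2 (Suc r) (\<lambda>i. \<psi> (face G1 A1 r i f y))"
    using tgt.coboundary_eq_alt_sum[OF pull_closed[OF f] x] by simp
  also have "\<dots> = \<psi> (src.d r f y)"
    using hom_alt_sum(1)[OF src.mdl.abelian_group_axioms tgt.mdl.abelian_group_axioms \<psi>_hom]
    by (simp add: src.coboundary_eq_alt_sum[OF f y] src.face_closed[OF f y])
  finally show "tgt.d r (pull r f) x = pull (Suc r) (src.d r f) x"
    using x by (simp add: pull_apply y_def)
qed (use f in \<open>auto simp: pull_closed src.coboundary_closed tgt.coboundary_closed\<close>)

lemma pull_cocycles: "f \<in> cocycles G1 A1 r \<Longrightarrow> pull r f \<in> cocycles G2 A2 r"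
  by (simp add: src.cocycles_iff tgt.cocycles_iff pull_closed pull_coboundary)

lemma pull_coboundaries: "b \<in> coboundaries G1 A1 r \<Longrightarrow> pull r b \<in> coboundaries G2 A2 r"
  by (cases r) (auto simp: coboundaries_def pull_coboundary[symmetric] pull_closed)

lemma cohom_class_pull:
  assumes "f \<in> cocycles G1 A1 r" "g \<in> cocycles G1 A1 r"
    and "cohom_class G1 A1 r f = cohom_class G1 A1 r g"
  shows "cohom_class G2 A2 r (pull r f) = cohom_class G2 A2 r (pull r g)"
proof -
  have fg: "f \<in> carrier (src.C r)" "g \<in> carrier (src.C r)"
    using assms by (simp_all add: src.cocycles_iff)
  obtain b where b: "b \<in> coboundaries G1 A1 r" "f = b \<otimes>\<^bsub>src.C r\<^esub> g"
    using src.cohom_class_eqD[OF assms(3) fg(1)] .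
  have "b \<in> carrier (src.C r)"
    using b(1) src.subgroup_coboundaries[of r] by (rule subgroup.mem_carrier[rotated])
  then have "pull r f = pull r b \<otimes>\<^bsub>tgt.C r\<^esub> pull r g"
    using b(2) fg by simp
  then show ?thesis
    using tgt.cohom_class_eqI[OF pull_coboundaries[OF b(1)] pull_closed[OF fg(2)]] by simp
qed

text \<open>Evaluates the definite description on any cocycle; uniqueness holds because a
  pulled-back coboundary is a coboundary.\<close>

lemma induced_map_cohom_class:
  assumes "f \<in> cocycles G1 A1 r"
  shows "induced_map G1 A1 G2 A2 \<phi> \<psi> r (cohom_class G1 A1 r f) = cohom_class G2 A2 r (pull r f)"
  unfolding induced_map_def
proof (rule the_equality)
  fix \<gamma>
  assume "\<exists>g\<in>cocycles G1 A1 r. cohom_class G1 A1 r g = cohom_class G1 A1 r f \<and>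
      \<gamma> = cohom_class G2 A2 r (pull r g)"
  then show "\<gamma> = cohom_class G2 A2 r (pull r f)"
    using cohom_class_pull assms by blast
qed (use assms in blast)

end

section \<open>Cup products\<close>

text \<open>The group element that twists the second factor in \<open>cup\<close>. The number of
  factors is independent of the length of the tuple, so initial segments are covered.\<close>

definition tuple_prod :: "'g top_group \<Rightarrow> (nat \<Rightarrow> 'g) \<Rightarrow> nat \<Rightarrow> 'g" where
  "tuple_prod G x r = foldr (mult G) (map x [0..<r]) \<one>\<^bsub>G\<^esub>"

lemma tuple_prod_0 [simp]: "tuple_prod G x 0 = \<one>\<^bsub>G\<^esub>"
  by (simp add: tuple_prod_def)

lemma tuple_prod_cong: "(\<And>k. k < r \<Longrightarrow> x k = y k) \<Longrightarrow> tuple_prod G x r = tuple_prod G y r"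
  unfolding tuple_prod_def by (metis (mono_tags, lifting) atLeastLessThan_iff map_cong set_upt)

context profinite_top_group
begin

lemma tuple_prod_closed:
  "(\<And>k. k < r \<Longrightarrow> x k \<in> carrier G) \<Longrightarrow> tuple_prod G x r \<in> carrier G"
  unfolding tuple_prod_def using grp.multlist_closed by fastforce

text \<open>A \<open>foldr\<close> consumes its list from the front, whereas a longer segment gains
  its new entry at the end; moving the start value out of the fold reconciles the two.\<close>

lemma foldr_mult_one:
  "set xs \<subseteq> carrier G \<Longrightarrow> a \<in> carrier G \<Longrightarrow>
   foldr (mult G) xs \<one>\<^bsub>G\<^esub> \<in> carrier G \<and> foldr (mult G) xs a = foldr (mult G) xs \<one>\<^bsub>G\<^esub> \<otimes>\<^bsub>G\<^esub> a"
  by (induction xs) (simp_all add: grp.m_assoc)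

lemma tuple_prod_Suc:
  assumes "\<And>k. k \<le> r \<Longrightarrow> x k \<in> carrier G"
  shows "tuple_prod G x (Suc r) = tuple_prod G x r \<otimes>\<^bsub>G\<^esub> x r"
proof -
  have "set (map x [0..<r]) \<subseteq> carrier G"
    using assms by auto
  then show ?thesis
    using foldr_mult_one[of "map x [0..<r]" "x r"] assms[of r] by (simp add: tuple_prod_def)
qed

lemma tuple_prod_Suc_shift:
  "tuple_prod G x (Suc r) = x 0 \<otimes>\<^bsub>G\<^esub> tuple_prod G (\<lambda>k. x (Suc k)) r"
  unfolding tuple_prod_def by (simp add: upt_rec[of 0 "Suc r"] map_Suc_upt[symmetric] o_def del: upt_Suc)

text \<open>The merge takes place inside the segment, so the \<open>r\<close> merged entries contain
  the first \<open>r + 1\<close> original ones.\<close>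

lemma tuple_prod_merge_at:
  assumes "x \<in> tuples G (Suc n)" "0 < i" "i \<le> r" "r \<le> n"
  shows "tuple_prod G (merge_at G n i x) r = tuple_prod G x (Suc r)"
  using assms(3,4)
proof (induction r)
  case 0
  then show ?case using assms(2) by simp
next
  case (Suc r)
  have x: "x k \<in> carrier G" if "k \<le> Suc r" for k
    using assms(1) Suc.prems that by (auto intro: tuples_component)
  have m: "merge_at G n i x k \<in> carrier G" if "k \<le> r" for k
    using tuples_component[OF merge_at_tuples[OF assms(1)]] Suc.prems that by simp
  show ?case
  proof (cases "i = Suc r")
    case True
    then have "tuple_prod G (merge_at G n i x) r = tuple_prod G x r"
      using Suc.prems by (intro tuple_prod_cong) (simp add: merge_at_def)
    moreover have "merge_at G n i x r = x r \<otimes>\<^bsub>G\<^esub> x (Suc r)"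
      using True Suc.prems by (simp add: merge_at_def)
    moreover have "tuple_prod G x r \<in> carrier G"
      using x by (intro tuple_prod_closed) simp
    ultimately show ?thesis
      using x m by (simp add: tuple_prod_Suc grp.m_assoc)
  next
    case False
    then have "merge_at G n i x r = x (Suc r)"
      using Suc.prems by (simp add: merge_at_def)
    then show ?thesis
      using Suc False x m by (simp add: tuple_prod_Suc)
  qed
qed

lemma continuous_map_tuple_prod:
  assumes "r \<le> n"
  shows "continuous_map (tuple_top G n) (group_top G) (\<lambda>x. tuple_prod G x r)"
  using assms
proof (induction r)
  case (Suc r)
  have "continuous_map (tuple_top G n) (group_top G) (\<lambda>x. tuple_prod G x r \<otimes>\<^bsub>G\<^esub> x r)"
    using Suc by (intro continuous_map_mult continuous_map_tuple_component) auto
  then show ?case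
    by (rule continuous_map_eq)
      (use Suc.prems in \<open>auto intro!: tuple_prod_Suc[symmetric] tuples_component\<close>)
qed simp

end

locale gmodule_pairing =
  profinite_top_group G + ma: discrete_gmodule G A + mb: discrete_gmodule G B +
  mc: discrete_gmodule G D
  for G :: "'g top_group" and A :: "('g, 'a) module" and B :: "('g, 'b) module"
    and D :: "('g, 'c) module" +
  fixes p :: "'a \<Rightarrow> 'b \<Rightarrow> 'c"
  assumes bilinear: "G_bilinear G A B D p"
begin

abbreviation cp :: "nat \<Rightarrow> nat \<Rightarrow> ((nat \<Rightarrow> 'g) \<Rightarrow> 'a) \<Rightarrow> ((nat \<Rightarrow> 'g) \<Rightarrow> 'b) \<Rightarrow> (nat \<Rightarrow> 'g) \<Rightarrow> 'c" where
  "cp \<equiv> cup G B p"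

lemma pairing_closed: "a \<in> carrier A \<Longrightarrow> b \<in> carrier B \<Longrightarrow> p a b \<in> carrier D"
  using bilinear by (simp add: G_bilinear_def)

lemma pairing_add_left:
  "a \<in> carrier A \<Longrightarrow> a' \<in> carrier A \<Longrightarrow> b \<in> carrier B \<Longrightarrow>
   p (a \<oplus>\<^bsub>A\<^esub> a') b = p a b \<oplus>\<^bsub>D\<^esub> p a' b"
  using bilinear by (simp add: G_bilinear_def)

lemma pairing_add_right:
  "a \<in> carrier A \<Longrightarrow> b \<in> carrier B \<Longrightarrow> b' \<in> carrier B \<Longrightarrow>
   p a (b \<oplus>\<^bsub>B\<^esub> b') = p a b \<oplus>\<^bsub>D\<^esub> p a b'"
  using bilinear by (simp add: G_bilinear_def)

lemma pairing_act:
  "g \<in> carrier G \<Longrightarrow> a \<in> carrier A \<Longrightarrow> b \<in> carrier B \<Longrightarrow>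
   g \<odot>\<^bsub>D\<^esub> p a b = p (g \<odot>\<^bsub>A\<^esub> a) (g \<odot>\<^bsub>B\<^esub> b)"
  using bilinear by (simp add: G_bilinear_def)

lemma cup_apply:
  "x \<in> tuples G (r + s) \<Longrightarrow>
   cp r s f g x = p (f (restrict x {..<r})) (tuple_prod G x r \<odot>\<^bsub>B\<^esub> g (\<lambda>k\<in>{..<s}. x (r + k)))"
  by (simp add: cup_def tuple_prod_def)

lemma cup_args_closed:
  assumes "x \<in> tuples G (r + s)"
  shows "f \<in> carrier (ma.C r) \<Longrightarrow> f (restrict x {..<r}) \<in> carrier A"
    and "g \<in> carrier (mb.C s) \<Longrightarrow> g (\<lambda>k\<in>{..<s}. x (r + k)) \<in> carrier B"
    and "tuple_prod G x r \<in> carrier G"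
  using assms
  by (auto intro!: ma.cochain_closed mb.cochain_closed restrict_tuples shift_tuples tuple_prod_closed
      tuples_component)

lemma cup_closed:
  assumes f: "f \<in> carrier (ma.C r)" and g: "g \<in> carrier (mb.C s)"
  shows "cp r s f g \<in> carrier (mc.C (r + s))"
proof -
  have "continuous_map (tuple_top G (r + s)) (tuple_top G r) (\<lambda>x. \<lambda>k\<in>{..<r}. x k)"
    by (intro continuous_map_into_tuple_top continuous_map_tuple_component) simp
  from continuous_map_compose[OF this ma.cochain_continuous[OF f]]
  have 1: "continuous_map (tuple_top G (r + s)) (discrete_topology (carrier A))
      (\<lambda>x. f (restrict x {..<r}))"
    by (simp add: o_def)
  have "continuous_map (tuple_top G (r + s)) (tuple_top G s) (\<lambda>x. \<lambda>k\<in>{..<s}. x (r + k))"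
    by (intro continuous_map_into_tuple_top continuous_map_tuple_component) simp
  from continuous_map_compose[OF this mb.cochain_continuous[OF g]]
  have "continuous_map (tuple_top G (r + s)) (discrete_topology (carrier B))
      (\<lambda>x. g (\<lambda>k\<in>{..<s}. x (r + k)))"
    by (simp add: o_def)
  then have 2: "continuous_map (tuple_top G (r + s)) (discrete_topology (carrier B))
      (\<lambda>x. tuple_prod G x r \<odot>\<^bsub>B\<^esub> g (\<lambda>k\<in>{..<s}. x (r + k)))"
    by (intro mb.continuous_map_act continuous_map_tuple_prod) simp_all
  from mc.restrict_cochain[OF continuous_map_discrete2[OF 1 2 pairing_closed]] show ?thesis
    by (simp add: cup_def tuple_prod_def)
qed

lemma cup_hom_left:
  assumes "g \<in> carrier (mb.C s)"
  shows "(\<lambda>f. cp r s f g) \<in> hom (ma.C r) (mc.C (r + s))"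
proof (rule homI)
  fix f f' assume f: "f \<in> carrier (ma.C r)" "f' \<in> carrier (ma.C r)"
  show "cp r s (f \<otimes>\<^bsub>ma.C r\<^esub> f') g = cp r s f g \<otimes>\<^bsub>mc.C (r + s)\<^esub> cp r s f' g"
  proof (rule mc.cochain_eqI[of _ "r + s"])
    fix x assume x: "x \<in> tuples G (r + s)"
    note closed = cup_args_closed[OF x]
    show "cp r s (f \<otimes>\<^bsub>ma.C r\<^esub> f') g x = (cp r s f g \<otimes>\<^bsub>mc.C (r + s)\<^esub> cp r s f' g) x"
      using x f assms
      by (simp add: cup_apply mc.cochain_mult ma.cochain_mult restrict_tuples closed pairing_add_left)
  qed (use f assms in \<open>auto simp: cup_closed\<close>)
qed (use assms cup_closed in auto)

lemma cup_hom_right: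
  assumes "f \<in> carrier (ma.C r)"
  shows "(\<lambda>g. cp r s f g) \<in> hom (mb.C s) (mc.C (r + s))"
proof (rule homI)
  fix g g' assume g: "g \<in> carrier (mb.C s)" "g' \<in> carrier (mb.C s)"
  show "cp r s f (g \<otimes>\<^bsub>mb.C s\<^esub> g') = cp r s f g \<otimes>\<^bsub>mc.C (r + s)\<^esub> cp r s f g'"
  proof (rule mc.cochain_eqI[of _ "r + s"])
    fix x assume x: "x \<in> tuples G (r + s)"
    note closed = cup_args_closed[OF x]
    show "cp r s f (g \<otimes>\<^bsub>mb.C s\<^esub> g') x = (cp r s f g \<otimes>\<^bsub>mc.C (r + s)\<^esub> cp r s f g') x"
      using x g assms
      by (simp add: cup_apply mc.cochain_mult mb.cochain_mult shift_tuples closed mb.act_add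
          pairing_add_right)
  qed (use g assms in \<open>auto simp: cup_closed\<close>)
qed (use assms cup_closed in auto)

text \<open>These faces act on the arguments of \<open>f\<close>, and the twist absorbs one more
  entry. For \<open>i = 0\<close> equivariance of the pairing spreads \<open>x 0\<close> over both
  factors and the action law attaches it to the twist; for \<open>i > 0\<close> the entry enters
  through the merge.\<close>

lemma face_cup_left:
  assumes f: "f \<in> carrier (ma.C r)" and g: "g \<in> carrier (mb.C s)"
    and x: "x \<in> tuples G (Suc (r + s))" and i: "i \<le> r"
  shows "face G D (r + s) i (cp r s f g) x =
    p (face G A r i f (restrict x {..<Suc r}))
      (tuple_prod G x (Suc r) \<odot>\<^bsub>B\<^esub> g (\<lambda>k\<in>{..<s}. x (Suc r + k)))"
proof -
  define y where "y = merge_at G (r + s) i x"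
  have y: "y \<in> tuples G (r + s)"
    unfolding y_def by (rule merge_at_tuples[OF x])
  have left: "restrict y {..<r} = merge_at G r i (restrict x {..<Suc r})"
    by (auto simp: y_def merge_at_def)
  have right: "(\<lambda>k\<in>{..<s}. y (r + k)) = (\<lambda>k\<in>{..<s}. x (Suc r + k))"
    using i by (auto simp: y_def merge_at_def)
  note closed = cup_args_closed[OF y]
  show ?thesis
  proof (cases "i = 0")
    case True
    have xc: "x k \<in> carrier G" if "k \<le> r" for k
      using x that by (auto intro: tuples_component)
    have "tuple_prod G y r = tuple_prod G (\<lambda>k. x (Suc k)) r"
      using True by (intro tuple_prod_cong) (simp add: y_def merge_at_def)
    then have "tuple_prod G x (Suc r) = x 0 \<otimes>\<^bsub>G\<^esub> tuple_prod G y r"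
      by (simp add: tuple_prod_Suc_shift)
    moreover have "face G D (r + s) i (cp r s f g) x = x 0 \<odot>\<^bsub>D\<^esub> cp r s f g y"
      using True by (simp add: face_def y_def)
    ultimately show ?thesis
      using True xc[of 0] closed(1)[OF f] closed(2)[OF g] closed(3)
      by (simp add: cup_apply[OF y] pairing_act mb.act_mult face_def left right)
  next
    case False
    then have "tuple_prod G y r = tuple_prod G x (Suc r)"
      unfolding y_def using i by (intro tuple_prod_merge_at x) auto
    then show ?thesis
      using False cup_apply[OF y] by (simp add: face_def left right flip: y_def)
  qed
qed

text \<open>Merging beyond the first \<open>r\<close> entries affects neither the argument of
  \<open>f\<close> nor the twist. The offset \<open>Suc j\<close> skips the face \<open>0\<close> of
  \<open>g\<close>, which corresponds to no face of the cup product.\<close>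

lemma face_cup_right:
  assumes x: "x \<in> tuples G (Suc (r + s))" and j: "j \<le> s"
  shows "face G D (r + s) (Suc (r + j)) (cp r s f g) x =
    p (f (restrict x {..<r}))
      (tuple_prod G x r \<odot>\<^bsub>B\<^esub> face G B s (Suc j) g (\<lambda>k\<in>{..<Suc s}. x (r + k)))"
proof -
  define y where "y = merge_at G (r + s) (Suc (r + j)) x"
  have y: "y \<in> tuples G (r + s)"
    unfolding y_def by (rule merge_at_tuples[OF x])
  have left: "restrict y {..<r} = restrict x {..<r}"
    by (auto simp: y_def merge_at_def)
  have right: "(\<lambda>k\<in>{..<s}. y (r + k)) = merge_at G s (Suc j) (\<lambda>k\<in>{..<Suc s}. x (r + k))"
    by (auto simp: y_def merge_at_def)
  have "tuple_prod G y r = tuple_prod G x r"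
    by (intro tuple_prod_cong) (simp add: y_def merge_at_def)
  then show ?thesis
    using cup_apply[OF y] by (simp add: face_def left right flip: y_def)
qed

text \<open>The faces up to index \<open>r\<close> come from \<open>f\<close>, the later ones from
  \<open>g\<close>. The last face of \<open>f\<close> and the face \<open>0\<close> of
  \<open>g\<close> are absent from the cup product, but they give the same value and cancel in the
  sum of the two right-hand terms.\<close>

lemma coboundary_cup:
  assumes f: "f \<in> carrier (ma.C r)" and g: "g \<in> carrier (mb.C s)"
  shows "mc.d (r + s) (cp r s f g) =
    cp (Suc r) s (ma.d r f) g \<otimes>\<^bsub>mc.C (Suc (r + s))\<^esub>
    (cp r (Suc s) f (mb.d s g) [^]\<^bsub>mc.C (Suc (r + s))\<^esub> ((- 1 :: int) ^ r))"
proof (rule mc.cochain_eqI[of _ "Suc (r + s)"])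
  have fg: "cp r s f g \<in> carrier (mc.C (r + s))" using cup_closed[OF f g] .
  have dfg: "cp (Suc r) s (ma.d r f) g \<in> carrier (mc.C (Suc (r + s)))"
    using cup_closed[OF ma.coboundary_closed[OF f] g] by simp
  have fdg: "cp r (Suc s) f (mb.d s g) \<in> carrier (mc.C (Suc (r + s)))"
    using cup_closed[OF f mb.coboundary_closed[OF g]] by simp
  show "mc.d (r + s) (cp r s f g) \<in> carrier (mc.C (Suc (r + s)))"
    by (rule mc.coboundary_closed[OF fg])
  show "cp (Suc r) s (ma.d r f) g \<otimes>\<^bsub>mc.C (Suc (r + s))\<^esub>
      (cp r (Suc s) f (mb.d s g) [^]\<^bsub>mc.C (Suc (r + s))\<^esub> ((- 1 :: int) ^ r))
      \<in> carrier (mc.C (Suc (r + s)))"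
    using dfg fdg by simp
  fix x assume x: "x \<in> tuples G (Suc (r + s))"
  then have x1: "x \<in> tuples G (Suc r + s)" and x2: "x \<in> tuples G (r + Suc s)" by simp_all
  define xl where "xl = restrict x {..<Suc r}"
  define xr where "xr = (\<lambda>k\<in>{..<Suc s}. x (r + k))"
  have xl: "xl \<in> tuples G (Suc r)" unfolding xl_def by (rule restrict_tuples[OF x1])
  have xr: "xr \<in> tuples G (Suc s)" unfolding xr_def by (rule shift_tuples[OF x2])
  \<comment> \<open>Along the left faces the second argument \<open>b\<close> of the pairing is
    constant, along the right faces the first argument \<open>a\<close> and the twist
    \<open>h\<close> are; each family is therefore the image of faces under an additive map.\<close>
  define a where "a = f (restrict x {..<r})"
  define b where "b = tuple_prod G x (Suc r) \<odot>\<^bsub>B\<^esub> g (\<lambda>k\<in>{..<s}. x (Suc r + k))"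
  define h where "h = tuple_prod G x r"
  have a: "a \<in> carrier A" unfolding a_def by (rule cup_args_closed(1)[OF x2 f])
  have b: "b \<in> carrier B"
    unfolding b_def using cup_args_closed(2,3)[OF x1] g by auto
  have h: "h \<in> carrier G" unfolding h_def by (rule cup_args_closed(3)[OF x2])
  define u where "u i = p (face G A r i f xl) b" for i
  define v where "v i = p a (h \<odot>\<^bsub>B\<^esub> face G B s i g xr)" for i
  have u: "u i \<in> carrier D" and v: "v i \<in> carrier D" for i
    using ma.face_closed[OF f xl] mb.face_closed[OF g xr] a b h
    by (auto simp: u_def v_def pairing_closed)
  \<comment> \<open>Both terms pair \<open>a\<close> with the element of \<open>B\<close> obtained
    by letting the first \<open>r + 1\<close> entries act: on one side as a single product, on the
    other as \<open>h\<close> after \<open>x r\<close>.\<close>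
  have "u (Suc r) = v 0"
  proof -
    have "face G A r (Suc r) f xl = a"
      by (simp add: face_def merge_at_last xl_def a_def Int_absorb1)
    moreover have "face G B s 0 g xr = x r \<odot>\<^bsub>B\<^esub> g (\<lambda>k\<in>{..<s}. x (Suc r + k))"
      by (simp add: face_def merge_at_0 xr_def cong: restrict_cong)
    moreover have "tuple_prod G x (Suc r) = h \<otimes>\<^bsub>G\<^esub> x r"
      unfolding h_def using x by (intro tuple_prod_Suc) (auto intro: tuples_component)
    moreover have "x r \<in> carrier G" "g (\<lambda>k\<in>{..<s}. x (Suc r + k)) \<in> carrier B"
      using tuples_component[OF x, of r] cup_args_closed(2)[OF x1 g] by auto
    ultimately show ?thesis
      using h by (simp add: u_def v_def b_def mb.act_mult)
  qed
  then have "alt_sum D (Suc (r + s)) (\<lambda>i. face G D (r + s) i (cp r s f g) x) =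
      alt_sum D (Suc r) u \<oplus>\<^bsub>D\<^esub> alt_sign D r (alt_sum D (Suc s) v)"
    using u v face_cup_left[OF f g x] face_cup_right[OF x]
    by (intro mc.mdl.alt_sum_concat)
      (simp_all add: u_def v_def a_def b_def h_def xl_def xr_def)
  moreover have "alt_sum D (Suc r) u = cp (Suc r) s (ma.d r f) g x"
  proof -
    have "(\<lambda>a. p a b) \<in> hom (add_monoid A) (add_monoid D)"
      using b by (simp add: hom_def pairing_closed pairing_add_left)
    from hom_alt_sum(1)[OF ma.mdl.abelian_group_axioms mc.mdl.abelian_group_axioms this]
    show ?thesis
      unfolding cup_apply[OF x1]
      using ma.face_closed[OF f xl] ma.coboundary_eq_alt_sum[OF f xl]
      by (simp add: u_def[abs_def] b_def xl_def)
  qed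
  moreover have "alt_sum D (Suc s) v = cp r (Suc s) f (mb.d s g) x"
  proof -
    have "(\<lambda>b. p a (h \<odot>\<^bsub>B\<^esub> b)) \<in> hom (add_monoid B) (add_monoid D)"
      using a h by (simp add: hom_def pairing_closed pairing_add_right mb.act_add)
    from hom_alt_sum(1)[OF mb.mdl.abelian_group_axioms mc.mdl.abelian_group_axioms this]
    show ?thesis
      unfolding cup_apply[OF x2]
      using mb.face_closed[OF g xr] mb.coboundary_eq_alt_sum[OF g xr]
      by (simp add: v_def[abs_def] a_def h_def xr_def)
  qed
  ultimately show "mc.d (r + s) (cp r s f g) x =
      (cp (Suc r) s (ma.d r f) g \<otimes>\<^bsub>mc.C (Suc (r + s))\<^esub>
       (cp r (Suc s) f (mb.d s g) [^]\<^bsub>mc.C (Suc (r + s))\<^esub> ((- 1 :: int) ^ r))) x"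
    using x fdg mc.coboundary_eq_alt_sum[OF fg x] by (simp add: mc.cochain_mult mc.cochain_sign)
qed

end

text \<open>Multiplicativity of \<open>\<phi>\<close> carries the twisting product to the twisting
  product, after which the two values differ only by the compatibility of the pairings. Stated for a
  single pairing so that it serves both pairings of a Tate product.\<close>

lemma pull_cup:
  assumes "gmodule_pairing G1 A1 B1 D1 p1" "gmodule_pairing G2 A2 B2 D2 p2"
    and "gmodule_morphism G1 A1 G2 A2 \<phi> \<psi>A" "gmodule_morphism G1 B1 G2 B2 \<phi> \<psi>B"
    and "\<And>a b. a \<in> carrier A1 \<Longrightarrow> b \<in> carrier B1 \<Longrightarrow> \<psi>D (p1 a b) = p2 (\<psi>A a) (\<psi>B b)"
    and f: "f \<in> carrier (cochains G1 A1 r)" and g: "g \<in> carrier (cochains G1 B1 s)"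
  shows "pull_cochain G2 \<phi> \<psi>D (r + s) (cup G1 B1 p1 r s f g) =
    cup G2 B2 p2 r s (pull_cochain G2 \<phi> \<psi>A r f) (pull_cochain G2 \<phi> \<psi>B s g)"
proof -
  interpret p1: gmodule_pairing G1 A1 B1 D1 p1 by fact
  interpret p2: gmodule_pairing G2 A2 B2 D2 p2 by fact
  interpret A: gmodule_morphism G1 A1 G2 A2 \<phi> \<psi>A by fact
  interpret B: gmodule_morphism G1 B1 G2 B2 \<phi> \<psi>B by fact
  have "\<phi> (tuple_prod G2 x n) = tuple_prod G1 (\<lambda>k. \<phi> (x k)) n" if "\<And>k. k < n \<Longrightarrow> x k \<in> carrier G2" for x n
    using that
  proof (induction n)
    case 0
    show ?case
      using hom_one[of \<phi> G2 G1] A.profinite_hom p1.grp.is_group p2.grp.is_group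
      by (simp add: profinite_hom_def)
  next
    case (Suc n)
    then show ?case
      using p2.tuple_prod_closed[of n x]
      by (simp add: p1.tuple_prod_Suc p2.tuple_prod_Suc A.\<phi>_mult A.\<phi>_closed)
  qed
  note prod = this
  show ?thesis
  proof
    fix x
    show "pull_cochain G2 \<phi> \<psi>D (r + s) (cup G1 B1 p1 r s f g) x =
      cup G2 B2 p2 r s (pull_cochain G2 \<phi> \<psi>A r f) (pull_cochain G2 \<phi> \<psi>B s g) x"
    proof (cases "x \<in> tuples G2 (r + s)")
      case True
      define y where "y = (\<lambda>k\<in>{..<r + s}. \<phi> (x k))"
      have y: "y \<in> tuples G1 (r + s)" unfolding y_def by (rule A.map_tuple[OF True])
      have l: "(\<lambda>k\<in>{..<r}. \<phi> (restrict x {..<r} k)) = restrict y {..<r}"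
        by (auto simp: y_def)
      have r: "(\<lambda>k\<in>{..<s}. \<phi> ((\<lambda>k\<in>{..<s}. x (r + k)) k)) = (\<lambda>k\<in>{..<s}. y (r + k))"
        by (auto simp: y_def)
      have "tuple_prod G1 y r = tuple_prod G1 (\<lambda>k. \<phi> (x k)) r"
        by (intro tuple_prod_cong) (simp add: y_def)
      also have "\<dots> = \<phi> (tuple_prod G2 x r)"
        using True by (intro prod[symmetric]) (auto intro: tuples_component)
      finally have m: "tuple_prod G1 y r = \<phi> (tuple_prod G2 x r)" .
      note closed = p1.cup_args_closed[OF y] p2.cup_args_closed[OF True]
      have "pull_cochain G2 \<phi> \<psi>D (r + s) (cup G1 B1 p1 r s f g) x = \<psi>D (cup G1 B1 p1 r s f g y)"
        using True by (simp add: pull_cochain_def y_def)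
      also have "\<dots> = p2 (\<psi>A (f (restrict y {..<r})))
          (tuple_prod G2 x r \<odot>\<^bsub>B2\<^esub> \<psi>B (g (\<lambda>k\<in>{..<s}. y (r + k))))"
        unfolding p1.cup_apply[OF y] using closed f g m
        by (simp add: assms(5) B.\<psi>_act A.\<phi>_closed del: restrict_apply)
      also have "\<dots> = cup G2 B2 p2 r s (pull_cochain G2 \<phi> \<psi>A r f) (pull_cochain G2 \<phi> \<psi>B s g) x"
        unfolding p2.cup_apply[OF True]
          A.pull_apply[OF restrict_tuples[OF True]] B.pull_apply[OF shift_tuples[OF True]] l r ..
      finally show ?thesis .
    qed (simp add: pull_cochain_def cup_def)
  qed
qed

section \<open>Short exact sequences and lifted cochains\<close>

text \<open>A commutative square of coefficient maps gives one of cochains, since relabelling the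
  arguments and mapping the values do not interfere. It is applied to both squares of a
  ladder.\<close>

lemma pull_cochain_commute:
  assumes "\<And>x. x \<in> tuples G1 r \<Longrightarrow> f x \<in> carrier A"
    and "\<And>g. g \<in> carrier G2 \<Longrightarrow> \<phi> g \<in> carrier G1"
    and "\<And>a. a \<in> carrier A \<Longrightarrow> \<psi> (h a) = h' (\<psi>' a)"
  shows "pull_cochain G2 \<phi> \<psi> r (pull_cochain G1 id h r f) =
    pull_cochain G2 id h' r (pull_cochain G2 \<phi> \<psi>' r f)"
proof
  fix x
  have "(\<lambda>k\<in>{..<r}. \<phi> (x k)) \<in> tuples G1 r" "restrict x {..<r} = x" if "x \<in> tuples G2 r"
    using that assms(2) by (auto simp: tuples_def PiE_iff extensional_restrict)
  moreover have "restrict (\<lambda>k\<in>{..<r}. \<phi> (x k)) {..<r} = (\<lambda>k\<in>{..<r}. \<phi> (x k))"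
    by simp
  ultimately show "pull_cochain G2 \<phi> \<psi> r (pull_cochain G1 id h r f) x =
      pull_cochain G2 id h' r (pull_cochain G2 \<phi> \<psi>' r f) x"
    using assms(1,3) by (simp add: pull_cochain_def)
qed

locale short_exact_gmodules =
  profinite_top_group G for G :: "'g top_group" +
  fixes A' :: "('g, 'a1) module" and i :: "'a1 \<Rightarrow> 'a" and A :: "('g, 'a) module"
    and j :: "'a \<Rightarrow> 'a2" and A'' :: "('g, 'a2) module"
  assumes exact: "short_exact G A' i A j A''"
begin

sublocale sub: discrete_gmodule G A'
  using exact by unfold_locales (simp add: short_exact_def)

sublocale mid: discrete_gmodule G A
  using exact by unfold_locales (simp add: short_exact_def)

sublocale quo: discrete_gmodule G A''
  using exact by unfold_locales (simp add: short_exact_def)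

sublocale incl: gmodule_morphism G A' G A id i
  using exact by unfold_locales (simp add: short_exact_def)

sublocale proj: gmodule_morphism G A G A'' id j
  using exact by unfold_locales (simp add: short_exact_def)

lemma i_inj: "inj_on i (carrier A')"
  using exact by (simp add: short_exact_def mon_def)

lemma j_surj: "j ` carrier A = carrier A''"
  using exact by (simp add: short_exact_def epi_def)

lemma i_image: "i ` carrier A' = {a \<in> carrier A. j a = \<zero>\<^bsub>A''\<^esub>}"
  using exact by (simp add: short_exact_def kernel_def)

lemma apply_id:
  "x \<in> tuples G r \<Longrightarrow> pull_cochain G id h r f x = h (f x)"
  by (simp add: pull_cochain_def tuples_def PiE_def extensional_restrict)

text \<open>Discreteness of the modules matters here: a set-theoretic section of \<open>j\<close> is
  automatically continuous, so composing with it lifts continuous cochains.\<close>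

lemma proj_surj:
  assumes "h \<in> carrier (quo.C r)"
  obtains f where "f \<in> carrier (mid.C r)" "proj.pull r f = h"
proof
  let ?f = "\<lambda>x\<in>tuples G r. inv_into (carrier A) j (h x)"
  have inv: "inv_into (carrier A) j a \<in> carrier A" "j (inv_into (carrier A) j a) = a"
    if "a \<in> carrier A''" for a
    using that j_surj by (auto intro: inv_into_into f_inv_into_f)
  show f: "?f \<in> carrier (mid.C r)"
    by (rule mid.restrict_cochain[OF continuous_map_discrete1[OF quo.cochain_continuous[OF assms] inv(1)]])
  show "proj.pull r ?f = h"
    by (rule quo.cochain_eqI[OF proj.pull_closed[OF f] assms])
      (simp add: apply_id inv(2) quo.cochain_closed[OF assms])
qed

lemma incl_inj:
  assumes "a \<in> carrier (sub.C r)" "b \<in> carrier (sub.C r)" "incl.pull r a = incl.pull r b"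
  shows "a = b"
proof (rule sub.cochain_eqI[OF assms(1,2)])
  fix x assume x: "x \<in> tuples G r"
  then have "i (a x) = i (b x)"
    using assms(3) apply_id by metis
  then show "a x = b x"
    using i_inj x assms sub.cochain_closed by (meson inj_onD)
qed

text \<open>Phrased with the same \<open>inv_into\<close> as \<open>aug_cochain\<close>, so that the
  two can be matched by unfolding. It is meaningful only for cochains with values in the image of
  \<open>i\<close>.\<close>

definition unincl :: "nat \<Rightarrow> ((nat \<Rightarrow> 'g) \<Rightarrow> 'a) \<Rightarrow> (nat \<Rightarrow> 'g) \<Rightarrow> 'a1" where
  "unincl r f = pull_cochain G id (inv_into (carrier A') i) r f"

lemma incl_unincl:
  assumes f: "f \<in> carrier (mid.C r)" and jf: "proj.pull r f = \<one>\<^bsub>quo.C r\<^esub>"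
  shows "unincl r f \<in> carrier (sub.C r)" "incl.pull r (unincl r f) = f"
proof -
  have im: "f x \<in> i ` carrier A'" if "x \<in> tuples G r" for x
    using that jf mid.cochain_closed[OF f that] apply_id[OF that, of j f] quo.cochain_one[OF that]
    by (simp add: i_image)
  \<comment> \<open>The inverse is given the value zero off the image of \<open>i\<close>, because
    the continuity argument needs a map of all of \<open>A\<close> into \<open>A'\<close>.\<close>
  let ?h = "\<lambda>a. if a \<in> i ` carrier A' then inv_into (carrier A') i a else \<zero>\<^bsub>A'\<^esub>"
  have "unincl r f = (\<lambda>x\<in>tuples G r. ?h (f x))"
    unfolding unincl_def pull_cochain_def using im
    by (intro restrict_ext) (simp add: tuples_def PiE_def extensional_restrict del: PiE_carrier)
  moreover have "?h a \<in> carrier A'" for a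
    by (auto intro: inv_into_into)
  ultimately show closed: "unincl r f \<in> carrier (sub.C r)"
    using sub.restrict_cochain[OF continuous_map_discrete1[OF mid.cochain_continuous[OF f], of ?h]]
    by simp
  show "incl.pull r (unincl r f) = f"
    by (rule mid.cochain_eqI[OF incl.pull_closed[OF closed] f])
      (simp add: apply_id unincl_def f_inv_into_f im)
qed

lemma proj_incl:
  assumes "a \<in> carrier (sub.C r)"
  shows "proj.pull r (incl.pull r a) = \<one>\<^bsub>quo.C r\<^esub>"
proof (rule quo.cochain_eqI[of _ r])
  fix x assume x: "x \<in> tuples G r"
  have "j (i (a x)) = \<zero>\<^bsub>A''\<^esub>"
    using i_image sub.cochain_closed[OF assms x] by auto
  then show "proj.pull r (incl.pull r a) x = \<one>\<^bsub>quo.C r\<^esub> x"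
    using x by (simp add: apply_id quo.cochain_one)
qed (use assms in \<open>auto intro: proj.pull_closed incl.pull_closed\<close>)

section \<open>Lifts of cocycles and the connecting cochain\<close>

definition lifts :: "nat \<Rightarrow> ((nat \<Rightarrow> 'g) \<Rightarrow> 'a) set" where
  "lifts r = {f \<in> carrier (mid.C r). proj.pull r f \<in> cocycles G A'' r}"

text \<open>On \<open>lifts r\<close> this is a cochain representing the connecting homomorphism
  from degree \<open>r\<close> of \<open>A''\<close> to degree \<open>r + 1\<close> of
  \<open>A'\<close>.\<close>

definition conn :: "nat \<Rightarrow> ((nat \<Rightarrow> 'g) \<Rightarrow> 'a) \<Rightarrow> (nat \<Rightarrow> 'g) \<Rightarrow> 'a1" where
  "conn r f = unincl (Suc r) (mid.d r f)"

lemma lifts_closed: "f \<in> lifts r \<Longrightarrow> f \<in> carrier (mid.C r)"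
  by (simp add: lifts_def)

lemma lifts_mult: "f \<in> lifts r \<Longrightarrow> g \<in> lifts r \<Longrightarrow> f \<otimes>\<^bsub>mid.C r\<^esub> g \<in> lifts r"
  using quo.subgroup_cocycles[of r] by (auto simp: lifts_def intro: subgroup.m_closed)

lemma conn:
  assumes "f \<in> lifts r"
  shows conn_closed: "conn r f \<in> carrier (sub.C (Suc r))"
    and incl_conn: "incl.pull (Suc r) (conn r f) = mid.d r f"
proof -
  have "proj.pull (Suc r) (mid.d r f) = \<one>\<^bsub>quo.C (Suc r)\<^esub>"
    using assms proj.pull_coboundary[of f r] by (simp add: lifts_def quo.cocycles_iff)
  from incl_unincl[OF mid.coboundary_closed[OF lifts_closed[OF assms]] this]
  show "conn r f \<in> carrier (sub.C (Suc r))" "incl.pull (Suc r) (conn r f) = mid.d r f"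
    by (simp_all add: conn_def)
qed

text \<open>Injectivity of \<open>i\<close> on cochains makes the equation characteristic.
  Additivity, the value on cocycles and on cochains from \<open>A'\<close>, and naturality of
  \<open>conn\<close> all follow by verifying this equation.\<close>

lemma conn_unique:
  assumes "f \<in> lifts r" "a \<in> carrier (sub.C (Suc r))" "incl.pull (Suc r) a = mid.d r f"
  shows "conn r f = a"
  using incl_inj[OF conn_closed[OF assms(1)] assms(2)] incl_conn[OF assms(1)] assms(3) by simp

lemma conn_mult:
  assumes "f \<in> lifts r" "g \<in> lifts r"
  shows "conn r (f \<otimes>\<^bsub>mid.C r\<^esub> g) = conn r f \<otimes>\<^bsub>sub.C (Suc r)\<^esub> conn r g"
  using assms by (intro conn_unique) (auto simp: lifts_mult conn_closed incl_conn lifts_closed)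

text \<open>After applying \<open>i\<close> the claim becomes \<open>d (d f)\<close> being
  trivial.\<close>

lemma coboundary_conn:
  assumes "f \<in> lifts r"
  shows "sub.d (Suc r) (conn r f) = \<one>\<^bsub>sub.C (Suc (Suc r))\<^esub>"
proof (rule incl_inj[of _ "Suc (Suc r)"])
  have "incl.pull (Suc (Suc r)) (sub.d (Suc r) (conn r f)) = mid.d (Suc r) (mid.d r f)"
    using incl.pull_coboundary[OF conn_closed[OF assms]] incl_conn[OF assms] by simp
  then show "incl.pull (Suc (Suc r)) (sub.d (Suc r) (conn r f)) =
      incl.pull (Suc (Suc r)) \<one>\<^bsub>sub.C (Suc (Suc r))\<^esub>"
    using mid.coboundary_coboundary[OF lifts_closed[OF assms]] by simp
qed (auto intro: sub.coboundary_closed conn_closed assms)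

lemma cocycles_subset_lifts: "cocycles G A r \<subseteq> lifts r"
  by (auto simp: lifts_def mid.cocycles_iff proj.pull_cocycles)

lemma conn_cocycle:
  assumes "f \<in> cocycles G A r"
  shows "conn r f = \<one>\<^bsub>sub.C (Suc r)\<^esub>"
  using assms cocycles_subset_lifts[of r] by (intro conn_unique) (auto simp: mid.cocycles_iff)

lemma incl_lifts: "a \<in> carrier (sub.C r) \<Longrightarrow> incl.pull r a \<in> lifts r"
  using subgroup.one_closed[OF quo.subgroup_cocycles]
  by (simp add: lifts_def incl.pull_closed proj_incl)

lemma conn_incl: "a \<in> carrier (sub.C r) \<Longrightarrow> conn r (incl.pull r a) = sub.d r a"
  by (intro conn_unique) (auto simp: incl_lifts sub.coboundary_closed incl.pull_coboundary)

text \<open>A coboundary with values in \<open>A''\<close> is the image of a coboundary with values in \<open>A\<close>, so two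
  lifts of cohomologous cocycles differ by such a coboundary and a cochain with values in \<open>A'\<close>.\<close>

lemma lifts_decomposition:
  assumes "f \<in> lifts r" "g \<in> lifts r"
    and "cohom_class G A'' r (proj.pull r f) = cohom_class G A'' r (proj.pull r g)"
  obtains e a where "e \<in> coboundaries G A r" "a \<in> carrier (sub.C r)"
    "f = e \<otimes>\<^bsub>mid.C r\<^esub> incl.pull r a \<otimes>\<^bsub>mid.C r\<^esub> g"
proof -
  note f = lifts_closed[OF assms(1)] and g = lifts_closed[OF assms(2)]
  obtain b where b: "b \<in> coboundaries G A'' r" "proj.pull r f = b \<otimes>\<^bsub>quo.C r\<^esub> proj.pull r g"
    using quo.cohom_class_eqD[OF assms(3) proj.pull_closed[OF f]] .
  obtain e where e: "e \<in> coboundaries G A r" "proj.pull r e = b"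
  proof (cases r)
    case 0
    with b(1) have "b = \<one>\<^bsub>quo.C 0\<^esub>" by (simp add: coboundaries_def)
    then show ?thesis
      using 0 by (intro that[of "\<one>\<^bsub>mid.C r\<^esub>"]) (simp_all add: coboundaries_def)
  next
    case (Suc q)
    with b(1) obtain h where h: "h \<in> carrier (quo.C q)" "b = quo.d q h"
      by (auto simp: coboundaries_def)
    obtain k where k: "k \<in> carrier (mid.C q)" "proj.pull q k = h"
      using proj_surj[OF h(1)] .
    show ?thesis
      using that[of "mid.d q k"] k h(2) Suc
      by (simp add: mid.coboundary_in_coboundaries proj.pull_coboundary[symmetric])
  qed
  have ec: "e \<in> carrier (mid.C r)"
    using e(1) mid.subgroup_coboundaries[of r] by (rule subgroup.mem_carrier[rotated])
  \<comment> \<open>What is left of \<open>f\<close> after removing \<open>e\<close> and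
    \<open>g\<close>. Its image in \<open>A''\<close> is trivial, as \<open>f\<close> and
    \<open>e\<close> times \<open>g\<close> have the same image, so exactness places it in
    \<open>A'\<close>.\<close>
  define c where "c = inv\<^bsub>mid.C r\<^esub> e \<otimes>\<^bsub>mid.C r\<^esub> f \<otimes>\<^bsub>mid.C r\<^esub> inv\<^bsub>mid.C r\<^esub> g"
  have c: "c \<in> carrier (mid.C r)" using ec f g by (simp add: c_def)
  have bc: "b \<in> carrier (quo.C r)" using e(2) proj.pull_closed[OF ec] by simp
  have "proj.pull r c = \<one>\<^bsub>quo.C r\<^esub>"
    using ec f g b(2) e(2) bc proj.pull_closed[OF g]
    by (simp add: c_def quo.cc.m_assoc[symmetric])
  from incl_unincl[OF c this] have "unincl r c \<in> carrier (sub.C r)" "incl.pull r (unincl r c) = c" .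
  moreover have "f = e \<otimes>\<^bsub>mid.C r\<^esub> c \<otimes>\<^bsub>mid.C r\<^esub> g"
    using ec f g by (simp add: c_def mid.cc.m_assoc)
      (simp add: mid.cc.m_assoc[symmetric])
  ultimately show ?thesis
    using that[of e "unincl r c"] e(1) by simp
qed

lemma cohomology_lift:
  assumes "\<alpha> \<in> carrier (cohomology G A'' r)"
  obtains f where "f \<in> lifts r" "\<alpha> = cohom_class G A'' r (proj.pull r f)"
proof -
  obtain h where h: "h \<in> cocycles G A'' r" "\<alpha> = cohom_class G A'' r h"
    using quo.cohomology_rep[OF assms] .
  then obtain f where "f \<in> carrier (mid.C r)" "proj.pull r f = h"
    using proj_surj[of h r] by (auto simp: quo.cocycles_iff)
  with h show ?thesis using that[of f] by (auto simp: lifts_def)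
qed

end

section \<open>The augmented cup product\<close>

locale tate_pairing = profinite_top_group G for G :: "'g top_group" +
  fixes P :: "('g, 'a1, 'a, 'a2, 'b1, 'b, 'b2, 'c) tate"
  assumes tate: "tate_product G P"
begin

sublocale sa: short_exact_gmodules G "modA' P" "inclA P" "modA P" "projA P" "modA'' P"
  using tate by unfold_locales (simp add: tate_product_def)

sublocale sb: short_exact_gmodules G "modB' P" "inclB P" "modB P" "projB P" "modB'' P"
  using tate by unfold_locales (simp add: tate_product_def)

sublocale mc: discrete_gmodule G "modC P"
  using tate by unfold_locales (simp add: tate_product_def)

sublocale p1: gmodule_pairing G "modA' P" "modB P" "modC P" "pair1 P"
  using tate by unfold_locales (simp add: tate_product_def)

sublocale p2: gmodule_pairing G "modA P" "modB' P" "modC P" "pair2 P"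
  using tate by unfold_locales (simp add: tate_product_def)

text \<open>The agreement of the two pairings on \<open>A' \<times> B'\<close>, lifted to cochains;
  equivariance of the inclusion of \<open>B'\<close> moves it past the twist.\<close>

lemma cup_compat:
  assumes a: "a \<in> carrier (sa.sub.C r)" and b: "b \<in> carrier (sb.sub.C s)"
  shows "p1.cp r s a (sb.incl.pull s b) = p2.cp r s (sa.incl.pull r a) b"
proof (rule mc.cochain_eqI[of _ "r + s"])
  fix x assume x: "x \<in> tuples G (r + s)"
  note closed = p1.cup_args_closed(1)[OF x a] p2.cup_args_closed(2)[OF x b] p1.cup_args_closed(3)[OF x]
  have compat: "pair1 P a (inclB P b) = pair2 P (inclA P a) b"
    if "a \<in> carrier (modA' P)" "b \<in> carrier (modB' P)" for a b
    using tate that by (simp add: tate_product_def)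
  show "p1.cp r s a (sb.incl.pull s b) x = p2.cp r s (sa.incl.pull r a) b x"
    using closed sb.incl.\<psi>_act[of "tuple_prod G x r" "b (\<lambda>k\<in>{..<s}. x (r + k))", symmetric]
    by (simp add: p1.cup_apply[OF x] p2.cup_apply[OF x] sb.apply_id[OF shift_tuples[OF x]]
        sa.apply_id[OF restrict_tuples[OF x]] compat)
qed (use a b in \<open>auto intro: p1.cup_closed p2.cup_closed sa.incl.pull_closed sb.incl.pull_closed\<close>)

abbreviation aug :: "nat \<Rightarrow> nat \<Rightarrow> ((nat \<Rightarrow> 'g) \<Rightarrow> 'a) \<Rightarrow> ((nat \<Rightarrow> 'g) \<Rightarrow> 'b) \<Rightarrow> (nat \<Rightarrow> 'g) \<Rightarrow> 'c" where
  "aug \<equiv> aug_cochain G P"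

text \<open>From here on the augmented cochain is handled through \<open>conn\<close> and its
  characteristic equation, instead of the inverse of an inclusion.\<close>

lemma aug_eq:
  "aug r s f g = p1.cp (Suc r) s (sa.conn r f) g \<otimes>\<^bsub>mc.C (Suc (r + s))\<^esub>
     (p2.cp r (Suc s) f (sb.conn s g) [^]\<^bsub>mc.C (Suc (r + s))\<^esub> ((- 1 :: int) ^ r))"
  by (simp add: aug_cochain_def Let_def push_cochain_eq_pull_cochain sa.conn_def sb.conn_def
      sa.unincl_def sb.unincl_def)

lemma cup1_closed:
  "f \<in> sa.lifts r \<Longrightarrow> g \<in> carrier (sb.mid.C s) \<Longrightarrow>
   p1.cp (Suc r) s (sa.conn r f) g \<in> carrier (mc.C (Suc (r + s)))"
  using p1.cup_closed[OF sa.conn_closed] by simp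

lemma cup2_closed:
  "f \<in> carrier (sa.mid.C r) \<Longrightarrow> g \<in> sb.lifts s \<Longrightarrow>
   p2.cp r (Suc s) f (sb.conn s g) \<in> carrier (mc.C (Suc (r + s)))"
  using p2.cup_closed[OF _ sb.conn_closed] by simp

lemma aug_closed:
  "f \<in> sa.lifts r \<Longrightarrow> g \<in> sb.lifts s \<Longrightarrow> aug r s f g \<in> carrier (mc.C (Suc (r + s)))"
  by (simp add: aug_eq cup1_closed cup2_closed sa.lifts_closed sb.lifts_closed)

text \<open>One homomorphism for each slot of each pairing; the numbers in later uses of
  \<open>cup_mult\<close> and \<open>cup_one\<close> refer to this order.\<close>

lemma hom_cup:
  "g \<in> carrier (sb.mid.C s) \<Longrightarrow>
    group_hom (sa.sub.C r) (mc.C (r + s)) (\<lambda>f. p1.cp r s f g)"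
  "f \<in> carrier (sa.sub.C r) \<Longrightarrow>
    group_hom (sb.mid.C s) (mc.C (r + s)) (\<lambda>g. p1.cp r s f g)"
  "g' \<in> carrier (sb.sub.C s) \<Longrightarrow>
    group_hom (sa.mid.C r) (mc.C (r + s)) (\<lambda>f. p2.cp r s f g')"
  "f' \<in> carrier (sa.mid.C r) \<Longrightarrow>
    group_hom (sb.sub.C s) (mc.C (r + s)) (\<lambda>g. p2.cp r s f' g)"
  by (simp_all add: group_hom_def group_hom_axioms_def p1.cup_hom_left p1.cup_hom_right
      p2.cup_hom_left p2.cup_hom_right)

lemmas cup_mult = hom_cup[THEN group_hom.hom_mult]
lemmas cup_one = hom_cup[THEN group_hom.hom_one]

section \<open>Biadditivity and closedness of the augmented cochain\<close>

lemma aug_mult_left: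
  assumes "f \<in> sa.lifts r" "f' \<in> sa.lifts r" "g \<in> sb.lifts s"
  shows "aug r s (f \<otimes>\<^bsub>sa.mid.C r\<^esub> f') g = aug r s f g \<otimes>\<^bsub>mc.C (Suc (r + s))\<^esub> aug r s f' g"
proof -
  note c = sa.conn_closed[OF assms(1)] sa.conn_closed[OF assms(2)] sb.conn_closed[OF assms(3)]
    sa.lifts_closed[OF assms(1)] sa.lifts_closed[OF assms(2)] sb.lifts_closed[OF assms(3)]
  have "p1.cp (Suc r) s (sa.conn r (f \<otimes>\<^bsub>sa.mid.C r\<^esub> f')) g =
      p1.cp (Suc r) s (sa.conn r f) g \<otimes>\<^bsub>mc.C (Suc (r + s))\<^esub> p1.cp (Suc r) s (sa.conn r f') g"
    using cup_mult(1)[OF c(6) c(1,2)] assms by (simp add: sa.conn_mult)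
  moreover have "p2.cp r (Suc s) (f \<otimes>\<^bsub>sa.mid.C r\<^esub> f') (sb.conn s g) =
      p2.cp r (Suc s) f (sb.conn s g) \<otimes>\<^bsub>mc.C (Suc (r + s))\<^esub> p2.cp r (Suc s) f' (sb.conn s g)"
    using cup_mult(3)[OF c(3) c(4,5)] by simp
  ultimately show ?thesis
    using assms c by (simp add: aug_eq mc.cc.int_pow_distrib cup1_closed cup2_closed mc.cc.m_ac)
qed

lemma aug_mult_right:
  assumes "f \<in> sa.lifts r" "g \<in> sb.lifts s" "g' \<in> sb.lifts s"
  shows "aug r s f (g \<otimes>\<^bsub>sb.mid.C s\<^esub> g') = aug r s f g \<otimes>\<^bsub>mc.C (Suc (r + s))\<^esub> aug r s f g'"
proof -
  note c = sb.conn_closed[OF assms(2)] sb.conn_closed[OF assms(3)] sa.conn_closed[OF assms(1)]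
    sb.lifts_closed[OF assms(2)] sb.lifts_closed[OF assms(3)] sa.lifts_closed[OF assms(1)]
  have "p2.cp r (Suc s) f (sb.conn s (g \<otimes>\<^bsub>sb.mid.C s\<^esub> g')) =
      p2.cp r (Suc s) f (sb.conn s g) \<otimes>\<^bsub>mc.C (Suc (r + s))\<^esub> p2.cp r (Suc s) f (sb.conn s g')"
    using cup_mult(4)[OF c(6) c(1,2)] assms by (simp add: sb.conn_mult)
  moreover have "p1.cp (Suc r) s (sa.conn r f) (g \<otimes>\<^bsub>sb.mid.C s\<^esub> g') =
      p1.cp (Suc r) s (sa.conn r f) g \<otimes>\<^bsub>mc.C (Suc (r + s))\<^esub> p1.cp (Suc r) s (sa.conn r f) g'"
    using cup_mult(2)[OF c(3) c(4,5)] by simp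
  ultimately show ?thesis
    using assms c by (simp add: aug_eq mc.cc.int_pow_distrib cup1_closed cup2_closed mc.cc.m_ac)
qed

lemma sign_sign:
  "f \<in> carrier (mc.C n) \<Longrightarrow>
   (f [^]\<^bsub>mc.C n\<^esub> ((- 1 :: int) ^ r)) [^]\<^bsub>mc.C n\<^esub> ((- 1 :: int) ^ r) = f"
  by (simp add: mc.cc.int_pow_pow power_mult_distrib[symmetric])

lemma sign_Suc_mult_sign:
  "f \<in> carrier (mc.C n) \<Longrightarrow>
   (f [^]\<^bsub>mc.C n\<^esub> ((- 1 :: int) ^ Suc r)) \<otimes>\<^bsub>mc.C n\<^esub> (f [^]\<^bsub>mc.C n\<^esub> ((- 1 :: int) ^ r)) = \<one>\<^bsub>mc.C n\<^esub>"
  by (simp add: mc.cc.int_pow_mult[symmetric])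

text \<open>As \<open>conn\<close> takes cocycle values, the Leibniz rule leaves one term from each
  summand: \<open>(-1)^(r+1)\<close> times \<open>\<partial>f \<union> d g\<close>, and
  \<open>(-1)^r\<close> times \<open>d f \<union> \<partial>g\<close>. By \<open>cup_compat\<close>
  both products are the same cochain \<open>m\<close>, and the opposite signs cancel.\<close>

lemma aug_cocycle:
  assumes f: "f \<in> sa.lifts r" and g: "g \<in> sb.lifts s"
  shows "aug r s f g \<in> cocycles G (modC P) (Suc (r + s))"
proof -
  let ?n = "Suc (Suc (r + s))"
  note c = sa.conn_closed[OF f] sb.conn_closed[OF g] sa.lifts_closed[OF f] sb.lifts_closed[OF g]
  define m where "m = p1.cp (Suc r) (Suc s) (sa.conn r f) (sb.mid.d s g)"
  have m: "m \<in> carrier (mc.C ?n)"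
    using p1.cup_closed[OF c(1) sb.mid.coboundary_closed[OF c(4)]] by (simp add: m_def)
  have "mc.d (Suc (r + s)) (p1.cp (Suc r) s (sa.conn r f) g) = m [^]\<^bsub>mc.C ?n\<^esub> ((- 1 :: int) ^ Suc r)"
    using p1.coboundary_cup[OF c(1) c(4)] cup_one(1)[OF c(4), of "Suc (Suc r)"] m
    by (simp add: sa.coboundary_conn[OF f] flip: m_def)
  moreover have "mc.d (Suc (r + s)) (p2.cp r (Suc s) f (sb.conn s g)) = m"
    using p2.coboundary_cup[OF c(3) c(2)] cup_one(4)[OF c(3), of "Suc (Suc s)"] m
      cup_compat[OF c(1,2)]
    by (simp add: sb.coboundary_conn[OF g] sa.incl_conn[OF f] sb.incl_conn[OF g] flip: m_def)
  ultimately have "mc.d (Suc (r + s)) (aug r s f g) = \<one>\<^bsub>mc.C ?n\<^esub>"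
    using m f g c sign_Suc_mult_sign[OF m, of r]
    by (simp add: aug_eq cup1_closed cup2_closed mc.cob.hom_int_pow)
  then show ?thesis
    using aug_closed[OF f g] by (simp add: mc.cocycles_iff)
qed

section \<open>Lifts whose augmented cochain is a coboundary\<close>

lemma coboundaries_int_pow:
  "b \<in> coboundaries G (modC P) n \<Longrightarrow> b [^]\<^bsub>mc.C n\<^esub> (k :: int) \<in> coboundaries G (modC P) n"
  by (rule mc.cc.subgroup_int_pow_closed[OF mc.subgroup_coboundaries])

text \<open>A coboundary is a cocycle, so \<open>conn r e\<close> is trivial and only
  \<open>e \<union> \<partial>g\<close> survives. For \<open>e = d h\<close> the Leibniz rule makes
  it \<open>d (h \<union> \<partial>g)\<close>, since \<open>\<partial>g\<close> is a cocycle; in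
  degree \<open>0\<close> the only coboundary is the neutral cochain.\<close>

lemma aug_coboundary_left:
  assumes e: "e \<in> coboundaries G (modA P) r" and g: "g \<in> sb.lifts s"
  shows "aug r s e g \<in> coboundaries G (modC P) (Suc (r + s))"
proof -
  note c = sb.conn_closed[OF g] sb.lifts_closed[OF g]
  have ez: "e \<in> cocycles G (modA P) r"
    using e sa.mid.coboundaries_subset_cocycles by blast
  then have el: "e \<in> sa.lifts r" and ec: "e \<in> carrier (sa.mid.C r)"
    using sa.cocycles_subset_lifts sa.lifts_closed by blast+
  have "p2.cp r (Suc s) e (sb.conn s g) \<in> coboundaries G (modC P) (Suc (r + s))"
  proof (cases r)
    case 0
    then have "e = \<one>\<^bsub>sa.mid.C r\<^esub>" using e by (simp add: coboundaries_def)
    then show ?thesis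
      using cup_one(3)[OF c(1), of r] subgroup.one_closed[OF mc.subgroup_coboundaries] by simp
  next
    case (Suc q)
    then obtain h where h: "h \<in> carrier (sa.mid.C q)" "e = sa.mid.d q h"
      using e by (auto simp: coboundaries_def)
    have "p2.cp q (Suc s) h (sb.conn s g) \<in> carrier (mc.C (q + Suc s))"
      using p2.cup_closed[OF h(1) c(1)] .
    moreover have "mc.d (q + Suc s) (p2.cp q (Suc s) h (sb.conn s g)) = p2.cp r (Suc s) e (sb.conn s g)"
      using p2.coboundary_cup[OF h(1) c(1)] cup_one(4)[OF h(1), of "Suc (Suc s)"]
        cup2_closed[OF ec g] Suc h(2)
      by (simp add: sb.coboundary_conn[OF g])
    ultimately show ?thesis
      using mc.coboundary_in_coboundaries[of _ "q + Suc s"] Suc by force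
  qed
  moreover have "p1.cp (Suc r) s (sa.conn r e) g = \<one>\<^bsub>mc.C (Suc (r + s))\<^esub>"
    using cup_one(1)[OF c(2), of "Suc r"] by (simp add: sa.conn_cocycle[OF ez])
  ultimately show ?thesis
    using cup2_closed[OF ec g] by (simp add: aug_eq coboundaries_int_pow)
qed

text \<open>The mirror image, where only \<open>\<partial>f \<union> e\<close> survives. For
  \<open>e = d h\<close> it is the coboundary of \<open>\<partial>f \<union> h\<close> up to the
  sign \<open>(-1)^(r+1)\<close>, as \<open>\<partial>f\<close> has degree
  \<open>r + 1\<close>.\<close>

lemma aug_coboundary_right:
  assumes f: "f \<in> sa.lifts r" and e: "e \<in> coboundaries G (modB P) s"
  shows "aug r s f e \<in> coboundaries G (modC P) (Suc (r + s))"
proof -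
  note c = sa.conn_closed[OF f] sa.lifts_closed[OF f]
  have ez: "e \<in> cocycles G (modB P) s"
    using e sb.mid.coboundaries_subset_cocycles by blast
  then have el: "e \<in> sb.lifts s" and ec: "e \<in> carrier (sb.mid.C s)"
    using sb.cocycles_subset_lifts sb.lifts_closed by blast+
  have "p1.cp (Suc r) s (sa.conn r f) e \<in> coboundaries G (modC P) (Suc (r + s))"
  proof (cases s)
    case 0
    then have "e = \<one>\<^bsub>sb.mid.C s\<^esub>" using e by (simp add: coboundaries_def)
    then show ?thesis
      using cup_one(2)[OF c(1), of s] subgroup.one_closed[OF mc.subgroup_coboundaries] by simp
  next
    case (Suc q)
    then obtain h where h: "h \<in> carrier (sb.mid.C q)" "e = sb.mid.d q h"
      using e by (auto simp: coboundaries_def)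
    let ?n = "Suc (Suc r + q)"
    let ?c = "p1.cp (Suc r) s (sa.conn r f) e"
    have hc: "p1.cp (Suc r) q (sa.conn r f) h \<in> carrier (mc.C (Suc r + q))"
      using p1.cup_closed[OF c(1) h(1)] .
    have cc: "?c \<in> carrier (mc.C ?n)"
      using cup1_closed[OF f ec] Suc by simp
    have "mc.d (Suc r + q) (p1.cp (Suc r) q (sa.conn r f) h) = ?c [^]\<^bsub>mc.C ?n\<^esub> ((- 1 :: int) ^ Suc r)"
      using p1.coboundary_cup[OF c(1) h(1)] cup_one(1)[OF h(1), of "Suc (Suc r)"] Suc h(2) cc
      by (simp add: sa.coboundary_conn[OF f])
    \<comment> \<open>Applying the sign a second time removes it.\<close>
    then have "?c = mc.d (Suc r + q) (p1.cp (Suc r) q (sa.conn r f) h) [^]\<^bsub>mc.C ?n\<^esub> ((- 1 :: int) ^ Suc r)"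
      by (simp only: sign_sign[OF cc])
    also have "\<dots> \<in> coboundaries G (modC P) ?n"
      by (intro coboundaries_int_pow mc.coboundary_in_coboundaries hc)
    finally show ?thesis using Suc by simp
  qed
  moreover have "p2.cp r (Suc s) f (sb.conn s e) = \<one>\<^bsub>mc.C (Suc (r + s))\<^esub>"
    using cup_one(4)[OF c(2), of "Suc s"] by (simp add: sb.conn_cocycle[OF ez])
  ultimately show ?thesis
    using cup1_closed[OF f ec] by (simp add: aug_eq)
qed

text \<open>Here \<open>conn\<close> returns \<open>d a\<close>, and \<open>cup_compat\<close> turns
  the second cup product into \<open>a \<union> d g\<close> for the other pairing; the sum is the
  Leibniz expansion of \<open>d (a \<union> g)\<close>.\<close>

lemma aug_incl_left:
  assumes a: "a \<in> carrier (sa.sub.C r)" and g: "g \<in> sb.lifts s"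
  shows "aug r s (sa.incl.pull r a) g \<in> coboundaries G (modC P) (Suc (r + s))"
proof -
  note c = sb.conn_closed[OF g] sb.lifts_closed[OF g]
  have "aug r s (sa.incl.pull r a) g = mc.d (r + s) (p1.cp r s a g)"
    using p1.coboundary_cup[OF a c(2)] cup_compat[OF a c(1)]
    by (simp add: aug_eq sa.conn_incl[OF a] sb.incl_conn[OF g])
  then show ?thesis
    using mc.coboundary_in_coboundaries[OF p1.cup_closed[OF a c(2)]] by simp
qed

text \<open>Symmetrically \<open>\<partial>f \<union> i b\<close> equals
  \<open>d f \<union> b\<close> under \<open>pair2\<close>, and the sum is the Leibniz expansion of
  \<open>d (f \<union> b)\<close>.\<close>

lemma aug_incl_right:
  assumes f: "f \<in> sa.lifts r" and b: "b \<in> carrier (sb.sub.C s)"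
  shows "aug r s f (sb.incl.pull s b) \<in> coboundaries G (modC P) (Suc (r + s))"
proof -
  note c = sa.conn_closed[OF f] sa.lifts_closed[OF f]
  have "aug r s f (sb.incl.pull s b) = mc.d (r + s) (p2.cp r s f b)"
    using p2.coboundary_cup[OF c(2) b] cup_compat[OF c(1) b]
    by (simp add: aug_eq sb.conn_incl[OF b] sa.incl_conn[OF f])
  then show ?thesis
    using mc.coboundary_in_coboundaries[OF p2.cup_closed[OF c(2) b]] by simp
qed

text \<open>The lifts are exchanged one at a time, through the intermediate pair \<open>f'\<close>
  and \<open>g\<close>. Each exchange splits off two factors that the preceding lemmas identify as
  coboundaries.\<close>

lemma aug_class_cong:
  assumes f: "f \<in> sa.lifts r" "f' \<in> sa.lifts r"
    and g: "g \<in> sb.lifts s" "g' \<in> sb.lifts s"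
    and ff': "cohom_class G (modA'' P) r (sa.proj.pull r f) =
      cohom_class G (modA'' P) r (sa.proj.pull r f')"
    and gg': "cohom_class G (modB'' P) s (sb.proj.pull s g) =
      cohom_class G (modB'' P) s (sb.proj.pull s g')"
  shows "cohom_class G (modC P) (Suc (r + s)) (aug r s f g) =
    cohom_class G (modC P) (Suc (r + s)) (aug r s f' g')"
proof -
  let ?B = "coboundaries G (modC P) (Suc (r + s))"
  note B_mult = subgroup.m_closed[OF mc.subgroup_coboundaries]
  obtain e a where ea: "e \<in> coboundaries G (modA P) r" "a \<in> carrier (sa.sub.C r)"
    "f = e \<otimes>\<^bsub>sa.mid.C r\<^esub> sa.incl.pull r a \<otimes>\<^bsub>sa.mid.C r\<^esub> f'"
    using sa.lifts_decomposition[OF f ff'] .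
  have ea': "e \<in> sa.lifts r" "sa.incl.pull r a \<in> sa.lifts r"
    using ea sa.mid.coboundaries_subset_cocycles sa.cocycles_subset_lifts sa.incl_lifts by blast+
  have "aug r s f g = aug r s e g \<otimes>\<^bsub>mc.C (Suc (r + s))\<^esub> aug r s (sa.incl.pull r a) g
      \<otimes>\<^bsub>mc.C (Suc (r + s))\<^esub> aug r s f' g"
    unfolding ea(3) using ea' f g by (simp add: aug_mult_left sa.lifts_mult)
  then have 1: "cohom_class G (modC P) (Suc (r + s)) (aug r s f g) =
      cohom_class G (modC P) (Suc (r + s)) (aug r s f' g)"
    using mc.cohom_class_eqI[OF B_mult[OF aug_coboundary_left[OF ea(1) g(1)] aug_incl_left[OF ea(2) g(1)]]
        aug_closed[OF f(2) g(1)]] by simp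
  obtain e b where eb: "e \<in> coboundaries G (modB P) s" "b \<in> carrier (sb.sub.C s)"
    "g = e \<otimes>\<^bsub>sb.mid.C s\<^esub> sb.incl.pull s b \<otimes>\<^bsub>sb.mid.C s\<^esub> g'"
    using sb.lifts_decomposition[OF g gg'] .
  have eb': "e \<in> sb.lifts s" "sb.incl.pull s b \<in> sb.lifts s"
    using eb sb.mid.coboundaries_subset_cocycles sb.cocycles_subset_lifts sb.incl_lifts by blast+
  have "aug r s f' g = aug r s f' e \<otimes>\<^bsub>mc.C (Suc (r + s))\<^esub> aug r s f' (sb.incl.pull s b)
      \<otimes>\<^bsub>mc.C (Suc (r + s))\<^esub> aug r s f' g'"
    unfolding eb(3) using eb' f g by (simp add: aug_mult_right sb.lifts_mult)
  then have 2: "cohom_class G (modC P) (Suc (r + s)) (aug r s f' g) =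
      cohom_class G (modC P) (Suc (r + s)) (aug r s f' g')"
    using mc.cohom_class_eqI[OF B_mult[OF aug_coboundary_right[OF f(2) eb(1)] aug_incl_right[OF f(2) eb(2)]]
        aug_closed[OF f(2) g(2)]] by simp
  show ?thesis using 1 2 by simp
qed

text \<open>Evaluates the definite description of \<open>aug_cup\<close> on any chosen lifts;
  uniqueness is \<open>aug_class_cong\<close>.\<close>

lemma aug_cup_cohom_class:
  assumes f: "f \<in> sa.lifts r" and g: "g \<in> sb.lifts s"
  shows "aug_cup G P r s (cohom_class G (modA'' P) r (sa.proj.pull r f))
      (cohom_class G (modB'' P) s (sb.proj.pull s g)) =
    cohom_class G (modC P) (Suc (r + s)) (aug r s f g)"
  unfolding aug_cup_def push_cochain_eq_pull_cochain
proof (rule the_equality, goal_cases)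
  case 1
  show ?case using f g by (auto simp: sa.lifts_def sb.lifts_def)
next
  case (2 \<gamma>)
  then obtain f' g' where fg': "f' \<in> sa.lifts r" "g' \<in> sb.lifts s"
    "cohom_class G (modA'' P) r (sa.proj.pull r f') = cohom_class G (modA'' P) r (sa.proj.pull r f)"
    "cohom_class G (modB'' P) s (sb.proj.pull s g') = cohom_class G (modB'' P) s (sb.proj.pull s g)"
    "\<gamma> = cohom_class G (modC P) (Suc (r + s)) (aug r s f' g')"
    by (auto simp: sa.lifts_def sb.lifts_def)
  then show ?case
    using aug_class_cong[OF fg'(1) f fg'(2) g] by simp
qed

end

text \<open>The right square of the ladder sends lifts to lifts. The left square shows that the
  pulled-back \<open>conn\<close> maps under \<open>i2\<close> to the coboundary of the pulled-back
  lift, which characterizes the connecting cochain over \<open>G2\<close>.\<close>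

lemma pull_conn:
  assumes "short_exact_gmodules G1 A1' i1 A1 j1 A1''" "short_exact_gmodules G2 A2' i2 A2 j2 A2''"
    and "gmodule_morphism G1 A1' G2 A2' \<phi> \<psi>'" "gmodule_morphism G1 A1 G2 A2 \<phi> \<psi>"
    and "gmodule_morphism G1 A1'' G2 A2'' \<phi> \<psi>''"
    and i: "\<And>a. a \<in> carrier A1' \<Longrightarrow> \<psi> (i1 a) = i2 (\<psi>' a)"
    and j: "\<And>a. a \<in> carrier A1 \<Longrightarrow> \<psi>'' (j1 a) = j2 (\<psi> a)"
    and f: "f \<in> short_exact_gmodules.lifts G1 A1 j1 A1'' r"
  shows "pull_cochain G2 \<phi> \<psi>'' r (pull_cochain G1 id j1 r f) =
      pull_cochain G2 id j2 r (pull_cochain G2 \<phi> \<psi> r f)"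
    and "pull_cochain G2 \<phi> \<psi> r f \<in> short_exact_gmodules.lifts G2 A2 j2 A2'' r"
    and "short_exact_gmodules.conn G2 A2' i2 A2 r (pull_cochain G2 \<phi> \<psi> r f) =
      pull_cochain G2 \<phi> \<psi>' (Suc r) (short_exact_gmodules.conn G1 A1' i1 A1 r f)"
proof -
  interpret s1: short_exact_gmodules G1 A1' i1 A1 j1 A1'' by fact
  interpret s2: short_exact_gmodules G2 A2' i2 A2 j2 A2'' by fact
  interpret m': gmodule_morphism G1 A1' G2 A2' \<phi> \<psi>' by fact
  interpret m: gmodule_morphism G1 A1 G2 A2 \<phi> \<psi> by fact
  interpret m'': gmodule_morphism G1 A1'' G2 A2'' \<phi> \<psi>'' by fact
  note fc = s1.lifts_closed[OF f] and nc = s1.conn_closed[OF f]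
  show eq: "pull_cochain G2 \<phi> \<psi>'' r (pull_cochain G1 id j1 r f) =
      pull_cochain G2 id j2 r (pull_cochain G2 \<phi> \<psi> r f)"
    by (rule pull_cochain_commute) (use s1.mid.cochain_closed[OF fc] m.\<phi>_closed j in auto)
  show lift: "m.pull r f \<in> s2.lifts r"
    using f m''.pull_cocycles[of "s1.proj.pull r f" r] m.pull_closed[OF fc]
    by (simp add: s1.lifts_def s2.lifts_def eq)
  show "s2.conn r (m.pull r f) = m'.pull (Suc r) (s1.conn r f)"
  proof (rule s2.conn_unique[OF lift m'.pull_closed[OF nc]])
    have "s2.incl.pull (Suc r) (m'.pull (Suc r) (s1.conn r f)) =
        m.pull (Suc r) (s1.incl.pull (Suc r) (s1.conn r f))"
      by (rule pull_cochain_commute[symmetric])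
        (use s1.sub.cochain_closed[OF nc] m.\<phi>_closed i in auto)
    then show "s2.incl.pull (Suc r) (m'.pull (Suc r) (s1.conn r f)) = s2.mid.d r (m.pull r f)"
      by (simp add: s1.incl_conn[OF f] m.pull_coboundary[OF fc])
  qed
qed

theorem proposition4p3:
  fixes G1 :: "'g top_group" and G2 :: "'h top_group"
    and P1 :: "('g, 'a1, 'a, 'a2, 'b1, 'b, 'b2, 'e) tate"
    and P2 :: "('h, 'c1, 'c, 'c2, 'd1, 'd, 'd2, 'f) tate"
    and \<phi> :: "'h \<Rightarrow> 'g"
    and \<psi> :: "('a1, 'c1, 'a, 'c, 'a2, 'c2, 'b1, 'd1, 'b, 'd, 'b2, 'd2, 'e, 'f) tate_maps"
    and r s :: nat
  assumes "profinite_group G1" and "profinite_group G2"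
    and "tate_product G1 P1" and "tate_product G2 P2"
    and "tate_morphism G1 P1 G2 P2 \<phi> \<psi>"
    and "\<alpha> \<in> carrier (cohomology G1 (modA'' P1) r)"
    and "\<beta> \<in> carrier (cohomology G1 (modB'' P1) s)"
  shows "induced_map G1 (modC P1) G2 (modC P2) \<phi> (mapC \<psi>) (r + s + 1) (aug_cup G1 P1 r s \<alpha> \<beta>) =
         aug_cup G2 P2 r s
           (induced_map G1 (modA'' P1) G2 (modA'' P2) \<phi> (mapA'' \<psi>) r \<alpha>)
           (induced_map G1 (modB'' P1) G2 (modB'' P2) \<phi> (mapB'' \<psi>) s \<beta>)"
proof -
  note mor = assms(5)[unfolded tate_morphism_def]
  interpret t1: tate_pairing G1 P1 using assms by unfold_locales
  interpret t2: tate_pairing G2 P2 using assms by unfold_locales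
  interpret A': gmodule_morphism G1 "modA' P1" G2 "modA' P2" \<phi> "mapA' \<psi>"
    using mor by unfold_locales simp
  interpret A: gmodule_morphism G1 "modA P1" G2 "modA P2" \<phi> "mapA \<psi>"
    using mor by unfold_locales simp
  interpret A'': gmodule_morphism G1 "modA'' P1" G2 "modA'' P2" \<phi> "mapA'' \<psi>"
    using mor by unfold_locales simp
  interpret B': gmodule_morphism G1 "modB' P1" G2 "modB' P2" \<phi> "mapB' \<psi>"
    using mor by unfold_locales simp
  interpret B: gmodule_morphism G1 "modB P1" G2 "modB P2" \<phi> "mapB \<psi>"
    using mor by unfold_locales simp
  interpret B'': gmodule_morphism G1 "modB'' P1" G2 "modB'' P2" \<phi> "mapB'' \<psi>"
    using mor by unfold_locales simp
  interpret C: gmodule_morphism G1 "modC P1" G2 "modC P2" \<phi> "mapC \<psi>"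
    using mor by unfold_locales simp
  obtain f where f: "f \<in> t1.sa.lifts r" "\<alpha> = cohom_class G1 (modA'' P1) r (t1.sa.proj.pull r f)"
    using t1.sa.cohomology_lift[OF assms(6)] .
  obtain g where g: "g \<in> t1.sb.lifts s" "\<beta> = cohom_class G1 (modB'' P1) s (t1.sb.proj.pull s g)"
    using t1.sb.cohomology_lift[OF assms(7)] .
  note fc = t1.sa.lifts_closed[OF f(1)] t1.sa.conn_closed[OF f(1)]
  note gc = t1.sb.lifts_closed[OF g(1)] t1.sb.conn_closed[OF g(1)]
  have pa: "A''.pull r (t1.sa.proj.pull r f) = t2.sa.proj.pull r (A.pull r f)"
      "A.pull r f \<in> t2.sa.lifts r"
      "t2.sa.conn r (A.pull r f) = A'.pull (Suc r) (t1.sa.conn r f)"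
    using pull_conn[OF t1.sa.short_exact_gmodules_axioms t2.sa.short_exact_gmodules_axioms
      A'.gmodule_morphism_axioms A.gmodule_morphism_axioms A''.gmodule_morphism_axioms _ _ f(1)] mor
    by simp_all
  have pb: "B''.pull s (t1.sb.proj.pull s g) = t2.sb.proj.pull s (B.pull s g)"
      "B.pull s g \<in> t2.sb.lifts s"
      "t2.sb.conn s (B.pull s g) = B'.pull (Suc s) (t1.sb.conn s g)"
    using pull_conn[OF t1.sb.short_exact_gmodules_axioms t2.sb.short_exact_gmodules_axioms
      B'.gmodule_morphism_axioms B.gmodule_morphism_axioms B''.gmodule_morphism_axioms _ _ g(1)] mor
    by simp_all
  have "C.pull (Suc (r + s)) (t1.p1.cp (Suc r) s (t1.sa.conn r f) g) =
      t2.p1.cp (Suc r) s (t2.sa.conn r (A.pull r f)) (B.pull s g)"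
    using pull_cup[OF t1.p1.gmodule_pairing_axioms t2.p1.gmodule_pairing_axioms
      A'.gmodule_morphism_axioms B.gmodule_morphism_axioms _ fc(2) gc(1), of "mapC \<psi>"] mor
    by (simp add: pa(3))
  moreover have "C.pull (Suc (r + s)) (t1.p2.cp r (Suc s) f (t1.sb.conn s g)) =
      t2.p2.cp r (Suc s) (A.pull r f) (t2.sb.conn s (B.pull s g))"
    using pull_cup[OF t1.p2.gmodule_pairing_axioms t2.p2.gmodule_pairing_axioms
      A.gmodule_morphism_axioms B'.gmodule_morphism_axioms _ fc(1) gc(2), of "mapC \<psi>"] mor
    by (simp add: pb(3))
  \<comment> \<open>The sign in front of the second summand passes through because pulling back is a
    homomorphism of cochain groups and so respects integer powers.\<close>
  ultimately have aug: "C.pull (Suc (r + s)) (t1.aug r s f g) = t2.aug r s (A.pull r f) (B.pull s g)"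
    using f(1) g(1) fc gc
    by (simp add: t1.aug_eq t2.aug_eq t1.cup1_closed t1.cup2_closed C.pul.hom_int_pow)
  \<comment> \<open>The description \<open>induced_map\<close> ranges over cocycle representatives,
    so \<open>aug_cocycle\<close> is what allows it to be evaluated on the augmented
    cochain.\<close>
  have "induced_map G1 (modC P1) G2 (modC P2) \<phi> (mapC \<psi>) (r + s + 1) (aug_cup G1 P1 r s \<alpha> \<beta>) =
      cohom_class G2 (modC P2) (Suc (r + s)) (C.pull (Suc (r + s)) (t1.aug r s f g))"
    using C.induced_map_cohom_class[OF t1.aug_cocycle[OF f(1) g(1)]]
    by (simp add: f(2) g(2) t1.aug_cup_cohom_class[OF f(1) g(1)])
  also have "\<dots> = aug_cup G2 P2 r s
      (cohom_class G2 (modA'' P2) r (A''.pull r (t1.sa.proj.pull r f)))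
      (cohom_class G2 (modB'' P2) s (B''.pull s (t1.sb.proj.pull s g)))"
    by (simp add: aug pa(1) pb(1) t2.aug_cup_cohom_class[OF pa(2) pb(2)])
  also have "\<dots> = aug_cup G2 P2 r s
      (induced_map G1 (modA'' P1) G2 (modA'' P2) \<phi> (mapA'' \<psi>) r \<alpha>)
      (induced_map G1 (modB'' P1) G2 (modB'' P2) \<phi> (mapB'' \<psi>) s \<beta>)"
    using f g A''.induced_map_cohom_class B''.induced_map_cohom_class
    by (simp add: t1.sa.lifts_def t1.sb.lifts_def)
  finally show ?thesis .
qed

end
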